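(* Let $G=\mathbb{Z}/p\mathbb{Z}$ with $p\geq 2$ a prime, let $A\subseteq G$ be a nonempty subset with $A+A\neq G$, and set $C=-\,(G\setminus(A+A))$. Let $K\in(2,3)$ be a real number, let $s\geq K^2$, and let $$c=\frac{-27K+9K^2+s(9+9K-9K^2+12K^3-4K^4)}{4s(3-K)K^4}.$$ Suppose $s\leq|A|\leq c\,p$, $|A+A|=2|A|+r\leq\frac34 p$ (with $r$ the integer defined by this equality), and $|A+A|<K|A|-3$. Then there are arithmetic progressions $P_A,P_C\subseteq G$ having a common difference such that $X\subseteq P_X$ and $|P_X|\leq|X|+r+1$ for all $X\in\{A,C\}$.
   Context: An arithmetic progression in $G$ with difference $d$ is a set $\{a,a+d,\dots,a+(n-1)d\}$. *)

theory Defs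
  imports "HOL-Analysis.Analysis" "HOL-Number_Theory.Residues"
begin

definition arith_progression :: "('a, 'b) ring_scheme \<Rightarrow> 'a \<Rightarrow> 'a set \<Rightarrow> bool" where
  "arith_progression R d P \<longleftrightarrow>
     d \<in> carrier R \<and>
     (\<exists>a \<in> carrier R. \<exists>n::nat. n \<ge> 1 \<and>
        P = {a \<oplus>\<^bsub>R\<^esub> [i] \<cdot>\<^bsub>R\<^esub> d | i. i < n})"

end

theory Submission
  imports Defs "HOL-Library.Set_Algebras"
begin

text \<open>
  Write \<open>a = |A|\<close> and \<open>t = |A + A|\<close>. The number of solutions of \<open>x - x' + y - y' = 0\<close> with
  \<open>x, x' \<in> A\<close> and \<open>y, y' \<in> A + A\<close> is large: for a difference \<open>h\<close> the set \<open>(A + A) \<inter> (A + A - h)\<close> contains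
  \<open>A + (A \<inter> (A - h))\<close> (Katz--Koester), whose size is bounded below by Cauchy--Davenport. Hence some
  nontrivial Fourier coefficient of \<open>A\<close> exceeds \<open>(2K - 3) a / 3\<close>, and some dilate of a subset \<open>A'\<close>
  with \<open>3 |A'| > K a > t + 3\<close> lies in a half circle. There \<open>A'\<close> behaves like a set of integers, so
  Freiman's \<open>3k - 4\<close> theorem puts it into a short progression and yields a progression of length
  \<open>2 |A'| - 1\<close> and of the same difference inside \<open>A' + A'\<close>. The complement \<open>D\<close> of \<open>A + A\<close> then lies
  in a progression short enough that \<open>D - A'\<close> is again a sumset of integers. It avoids \<open>A\<close>, so it has at
  most \<open>p - a\<close> elements, and because \<open>t \<le> 3p/4\<close> the two-set version of the theorem applies: \<open>D - A'\<close>
  contains a progression of length \<open>|D| + |A'| - 1\<close>. Therefore \<open>A\<close> itself lies in a progression of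
  length less than \<open>p/2 + 1\<close>, and Freiman's theorem for \<open>A\<close> gives both progressions.
\<close>

section \<open>Sumsets of dense sets of integers\<close>

text \<open>A missing sum \<open>k\<close> makes \<open>X\<close> disjoint from the reflection
  \<open>k - Y\<close>, so inside a window both compete for the same \<open>j - i + 1\<close>
  places. The condition \<open>i \<le> j + 1\<close> admits the empty window.\<close>

lemma card_add_card_le_of_not_sum:
  fixes X Y :: "int set"
  assumes "finite X" "finite Y" "k \<notin> X + Y" "i \<le> j + 1"
  shows "int (card (X \<inter> {i..j})) + int (card (Y \<inter> {k-j..k-i})) \<le> j - i + 1"
proof -
  let ?R = "(\<lambda>y. k - y) ` (Y \<inter> {k-j..k-i})"
  have "card ?R = card (Y \<inter> {k-j..k-i})" by (intro card_image inj_onI) auto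
  moreover have "X \<inter> {i..j} \<inter> ?R = {}"
    using assms(3) set_plus_intro[of _ X _ Y] by fastforce
  moreover have "X \<inter> {i..j} \<union> ?R \<subseteq> {i..j}" by auto
  ultimately have "card (X \<inter> {i..j}) + card (Y \<inter> {k-j..k-i}) \<le> card {i..j}"
    using card_Un_disjoint[of "X \<inter> {i..j}" ?R] card_mono[of "{i..j}" "X \<inter> {i..j} \<union> ?R"] assms(1,2)
    by simp
  then show ?thesis using assms(4) by simp
qed

text \<open>The translates \<open>Min A + B\<close> and \<open>A + Max B\<close> share only the
  corner \<open>Min A + Max B\<close>.\<close>

lemma card_set_plus_ge:
  fixes A B :: "int set"
  assumes "finite A" "finite B" "A \<noteq> {}" "B \<noteq> {}"
  shows "card A + card B \<le> card (A + B) + 1"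
proof -
  let ?L = "(\<lambda>b. Min A + b) ` B" and ?R = "(\<lambda>a. a + Max B) ` A"
  have mem: "Min A \<in> A" "Max B \<in> B" using assms by simp_all
  have "card ?L = card B" "card ?R = card A" by (intro card_image inj_onI; simp)+
  moreover have "?L \<union> ?R \<subseteq> A + B"
    using mem by (auto intro: set_plus_intro)
  then have "card (?L \<union> ?R) \<le> card (A + B)" by (intro card_mono finite_set_plus) (use assms in auto)
  moreover have "?L \<inter> ?R \<subseteq> {Min A + Max B}"
  proof
    fix w assume "w \<in> ?L \<inter> ?R"
    then obtain a b where "w = Min A + b" "b \<in> B" "w = a + Max B" "a \<in> A" by blast
    moreover from this have "b \<le> Max B" "Min A \<le> a" using assms by auto
    ultimately show "w \<in> {Min A + Max B}" by auto
  qed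
  then have "card (?L \<inter> ?R) \<le> 1" using card_mono[of "{Min A + Max B}" "?L \<inter> ?R"] by simp
  moreover have "card ?L + card ?R = card (?L \<union> ?R) + card (?L \<inter> ?R)"
    using assms by (intro card_Un_Int) auto
  ultimately show ?thesis by linarith
qed

lemma card_split3:
  fixes Z :: "int set"
  assumes "finite Z" "Z \<subseteq> {0..n}" "k + 1 \<le> l"
  shows "int (card Z) \<le> int (card (Z \<inter> {0..k})) + (l - k - 1) + int (card (Z \<inter> {l..n}))"
proof -
  have "Z \<subseteq> Z \<inter> {0..k} \<union> {k+1..l-1} \<union> Z \<inter> {l..n}" using assms(2) by auto
  then have "card Z \<le> card (Z \<inter> {0..k} \<union> {k+1..l-1} \<union> Z \<inter> {l..n})"
    by (intro card_mono) (use assms in auto)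
  also have "\<dots> \<le> card (Z \<inter> {0..k}) + card {k+1..l-1} + card (Z \<inter> {l..n})"
    by (meson add_le_mono1 card_Un_le le_trans)
  finally show ?thesis using assms(3) by simp
qed

lemma card_overlap:
  fixes Z :: "int set"
  assumes "finite Z" "Z \<subseteq> {0..n}" "l \<le> k + 1"
  shows "int (card Z) + int (card (Z \<inter> {l..k})) \<le> int (card (Z \<inter> {0..k})) + int (card (Z \<inter> {l..n}))"
proof -
  have "card (Z \<inter> {0..k}) + card (Z \<inter> {l..n})
      = card (Z \<inter> {0..k} \<union> Z \<inter> {l..n}) + card (Z \<inter> {0..k} \<inter> (Z \<inter> {l..n}))"
    by (intro card_Un_Int) (use assms in auto)
  moreover have "Z \<inter> {0..k} \<union> Z \<inter> {l..n} = Z" "Z \<inter> {0..k} \<inter> (Z \<inter> {l..n}) = Z \<inter> {l..k}"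
    using assms(2,3) by auto
  ultimately show ?thesis by simp
qed

section \<open>Two integer sets that are jointly dense in the longer enclosing interval\<close>

context
  fixes X Y :: "int set" and m n :: int
  assumes finX: "finite X" and finY: "finite Y"
    and XI: "X \<subseteq> {0..m}" and YI: "Y \<subseteq> {0..n}"
    and Y0: "0 \<in> Y" and Yn: "n \<in> Y" and m0: "0 \<le> m" and mn: "m \<le> n"
    and dense: "n + 3 \<le> int (card X) + int (card Y)"
begin

lemma sum_contains_middle:
  assumes "m \<le> k" "k \<le> n"
  shows "k \<in> X + Y"
proof (rule ccontr)
  assume k: "k \<notin> X + Y"
  have "X \<inter> {k-n..k} = X" "Y \<inter> {k-k..k-(k-n)} = Y" using XI YI assms by auto
  then show False using card_add_card_le_of_not_sum[OF finX finY k, of "k-n" k] dense m0 mn by simp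
qed

text \<open>The two missing sums bound \<open>X\<close> and \<open>Y\<close> on an initial and on a
  final window; the windows of \<open>X\<close> overlap in \<open>{r..k}\<close>, which is therefore
  counted twice.\<close>

lemma hole_pair:
  assumes "k \<notin> X + Y" "r + n \<notin> X + Y" "0 \<le> r" "r \<le> k" "k \<le> m"
  shows "int (card X) + int (card Y) + int (card (X \<inter> {r..k})) \<le> m + (k - r) + 2"
proof -
  have 1: "int (card (X \<inter> {0..k})) + int (card (Y \<inter> {0..k})) \<le> k + 1"
    using card_add_card_le_of_not_sum[OF finX finY assms(1), of 0 k] assms by simp
  have 2: "int (card (X \<inter> {r..m})) + int (card (Y \<inter> {n-m+r..n})) \<le> m - r + 1"
    using card_add_card_le_of_not_sum[OF finX finY assms(2), of r m] assms
    by (simp add: algebra_simps)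
  have 3: "int (card X) + int (card (X \<inter> {r..k})) \<le> int (card (X \<inter> {0..k})) + int (card (X \<inter> {r..m}))"
    by (rule card_overlap[OF finX XI]) (use assms in simp)
  show ?thesis
  proof (cases "n - m + r \<le> k + 1")
    case True
    show ?thesis using card_overlap[OF finY YI True] 1 2 3 by linarith
  next
    case False
    \<comment> \<open>When the windows of \<open>Y\<close> leave a gap, the bounds add up to at most
      \<open>n + 1\<close>, against \<open>dense\<close>.\<close>
    then have "int (card Y) \<le> int (card (Y \<inter> {0..k})) + (n-m+r - k - 1) + int (card (Y \<inter> {n-m+r..n}))"
      by (intro card_split3[OF finY YI]) simp
    then show ?thesis using 1 2 3 dense by linarith
  qed
qed

lemma sum_covers_residues:
  assumes "0 \<le> r" "r < n"
  shows "r \<in> X + Y \<or> r + n \<in> X + Y"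
proof (cases "r \<le> m")
  case True
  then show ?thesis using hole_pair[of r r] assms dense mn by fastforce
next
  case False
  then show ?thesis using sum_contains_middle[of r] assms by simp
qed

text \<open>Count modulo \<open>n\<close>. Below \<open>n\<close> only the residues in
  \<open>L\<close> are missing, and each of them is hit at \<open>r + n\<close>. From
  \<open>n\<close> upwards lie also the translates by \<open>n\<close> of \<open>X\<close>, because
  \<open>n \<in> Y\<close>, and those of \<open>E\<close>.\<close>

lemma card_sum_ge_doubly_covered:
  assumes "E \<subseteq> {0..<n}" "E \<inter> X = {}" "E \<subseteq> X + Y" "\<And>g. g \<in> E \<Longrightarrow> g + n \<in> X + Y"
  shows "n + int (card X) + int (card E) \<le> int (card (X + Y))"
proof -
  let ?S = "X + Y"
  have finS: "finite ?S" by (simp add: finX finY finite_set_plus)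
  have finE: "finite E" using assms(1) finite_subset by blast
  define L where "L = {0..<n} - ?S"
  let ?T = "(\<lambda>r. r + n) ` (L \<union> (X \<union> E))"
  have XS: "X \<subseteq> ?S" using Y0 set_plus_intro[of _ X 0 Y] by fastforce
  have T: "?T \<subseteq> ?S \<inter> {n..}"
  proof -
    have "r + n \<in> ?S" if "r \<in> X" for r using that Yn by (rule set_plus_intro)
    moreover have "r + n \<in> ?S" if "r \<in> L" for r
      using sum_covers_residues[of r] that by (auto simp: L_def)
    ultimately show ?thesis using assms(1,4) XI by (auto simp: L_def)
  qed
  have "card ?T = card (L \<union> (X \<union> E))" by (intro card_image inj_onI) auto
  also have "\<dots> = card L + card (X \<union> E)"
    using XS assms(3) finE finX by (intro card_Un_disjoint) (auto simp: L_def)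
  also have "card (X \<union> E) = card X + card E"
    using assms(2) finX finE by (intro card_Un_disjoint) auto
  finally have cT: "card ?T = card L + (card X + card E)" .
  have "card ({0..<n} \<inter> ?S) + card L = card {0..<n}"
    unfolding L_def using card_Diff_subset_Int[of "{0..<n}" ?S] card_mono[of "{0..<n}" "{0..<n} \<inter> ?S"] by simp
  moreover have "card ({0..<n} \<inter> ?S \<union> ?T) \<le> card ?S" using T finS by (intro card_mono) auto
  moreover have "card ({0..<n} \<inter> ?S \<union> ?T) = card ({0..<n} \<inter> ?S) + card ?T"
    using T finX finE by (intro card_Un_disjoint) (auto simp: L_def)
  ultimately show ?thesis using cT m0 mn by simp
qed

lemma card_sum_ge_span: "n + int (card X) \<le> int (card (X + Y))"
  using card_sum_ge_doubly_covered[of "{}"] by simp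

text \<open>If the claim fails, take \<open>r < k\<close> with \<open>k - r\<close> minimal. Every \<open>g\<close> strictly between \<open>r\<close> and \<open>k\<close> then has
  both \<open>g\<close> and \<open>g + n\<close> in \<open>X + Y\<close>, while the two missing sums force \<open>X\<close> to be sparse between
  \<open>r\<close> and \<open>k\<close>; so there are too many residues modulo \<open>n\<close> that are hit twice.\<close>
lemma holes_separated:
  assumes small: "int (card (X + Y)) \<le> 2 * int (card X) + int (card Y) - 4"
    and "k \<notin> X + Y" "r + n \<notin> X + Y" "0 \<le> r" "k \<le> m"
  shows "k < r"
proof (rule ccontr)
  assume "\<not> k < r"
  define P where "P d \<longleftrightarrow> (\<exists>k r. k \<notin> X + Y \<and> r + n \<notin> X + Y \<and> 0 \<le> r \<and> r \<le> k \<and> k \<le> m \<and> nat (k - r) = d)" for d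
  have "P (nat (k - r))" unfolding P_def using assms \<open>\<not> k < r\<close> not_less by blast
  then have "P (LEAST d. P d)" by (rule LeastI)
  then obtain k r where kr: "k \<notin> X + Y" "r + n \<notin> X + Y" "0 \<le> r" "r \<le> k" "k \<le> m"
    "nat (k - r) = (LEAST d. P d)" unfolding P_def by blast
  have least: "\<not> (k' \<notin> X + Y \<and> r' + n \<notin> X + Y \<and> 0 \<le> r' \<and> r' \<le> k' \<and> k' \<le> m)"
    if "k' - r' < k - r" for k' r'
  proof
    assume a: "k' \<notin> X + Y \<and> r' + n \<notin> X + Y \<and> 0 \<le> r' \<and> r' \<le> k' \<and> k' \<le> m"
    then have "P (nat (k' - r'))" unfolding P_def by blast
    then have "(LEAST d. P d) \<le> nat (k' - r')" by (rule Least_le)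
    then show False using kr a that by linarith
  qed
  have kX: "k \<notin> X" and rX: "r \<notin> X"
    using kr(1,2) Y0 Yn set_plus_intro[of k X 0 Y] set_plus_intro[of r X n Y] by auto
  define E where "E = {r+1..k-1} - X"
  have hp: "int (card X) + int (card Y) + int (card (X \<inter> {r..k})) \<le> m + (k - r) + 2"
    by (rule hole_pair) (use kr in auto)
  have "r \<noteq> k" using sum_covers_residues[of r] kr sum_contains_middle[of m] hp dense mn by force
  have "X \<inter> {r..k} = X \<inter> {r+1..k-1}" using kX rX by (auto simp: order_le_less)
  moreover have "card E + card (X \<inter> {r+1..k-1}) = card {r+1..k-1}"
    unfolding E_def using card_Diff_subset_Int[of "{r+1..k-1}" X] card_mono[of "{r+1..k-1}" "X \<inter> {r+1..k-1}"]
    by (simp add: Int_commute)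
  ultimately have "int (card E) \<ge> int (card X) + int (card Y) - m - 3"
    using hp \<open>r \<noteq> k\<close> kr(4) by simp
  moreover have "n + int (card X) + int (card E) \<le> int (card (X + Y))"
  proof (rule card_sum_ge_doubly_covered)
    show "E \<subseteq> {0..<n}" using kr mn by (auto simp: E_def)
    show "E \<inter> X = {}" by (auto simp: E_def)
    show "E \<subseteq> X + Y"
    proof
      fix g assume "g \<in> E"
      then show "g \<in> X + Y" using least[of g r] kr by (auto simp: E_def)
    qed
    show "g + n \<in> X + Y" if "g \<in> E" for g
      using least[of k g] kr that by (auto simp: E_def)
  qed
  ultimately show False using small mn by linarith
qed

text \<open>By \<open>holes_separated\<close>, the last hole \<open>k\<close> in
  \<open>{0..m}\<close> and the first hole \<open>r + n\<close> with \<open>r\<close> in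
  \<open>{0..m}\<close> satisfy \<open>k < r\<close>, so nothing is missing between them. Counting
  at both holes shows that they are at least \<open>|X| + |Y|\<close> apart.\<close>

lemma sum_contains_interval:
  assumes small: "int (card (X + Y)) \<le> 2 * int (card X) + int (card Y) - 4"
  shows "\<exists>u. {u..u + int (card X) + int (card Y) - 2} \<subseteq> X + Y"
proof -
  \<comment> \<open>The defaults \<open>-1\<close> and \<open>m + 1\<close> stand for the absence of
    a hole; the windows \<open>{0..k}\<close> and \<open>{r..m}\<close> are then empty.\<close>
  define k where "k = Max (insert (-1) ({0..m} - (X + Y)))"
  define r where "r = Min (insert (m+1) {r \<in> {0..m}. r + n \<notin> X + Y})"
  have kin: "k \<in> insert (-1) ({0..m} - (X + Y))" unfolding k_def by (rule Max_in) auto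
  have rin: "r \<in> insert (m+1) {r \<in> {0..m}. r + n \<notin> X + Y}" unfolding r_def
    by (rule Min_in) (auto intro: finite_subset[of _ "{0..m}"])
  have kmax: "i \<in> X + Y" if "k < i" "0 \<le> i" "i \<le> m" for i
    using that Max_ge[of "insert (-1) ({0..m} - (X + Y))" i] unfolding k_def[symmetric] by force
  have rmin: "i + n \<in> X + Y" if "i < r" "0 \<le> i" "i \<le> m" for i
  proof (rule ccontr)
    assume "i + n \<notin> X + Y"
    then have "r \<le> i" unfolding r_def
      using that by (intro Min_le) (auto intro: finite_subset[of _ "{0..m}"])
    then show False using that by simp
  qed
  have kb: "-1 \<le> k" "k \<le> m" and rb: "0 \<le> r" "r \<le> m + 1" using kin rin m0 by auto
  have kr: "k < r" using kin rin holes_separated[OF small, of k r] m0 by auto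
  have 1: "int (card (X \<inter> {0..k})) + int (card (Y \<inter> {0..k})) \<le> k + 1"
  proof (cases "k = -1")
    case False
    then have "k \<notin> X + Y" using kin by auto
    then show ?thesis using card_add_card_le_of_not_sum[OF finX finY, of k 0 k] kb by simp
  qed simp
  have 2: "int (card (X \<inter> {r..m})) + int (card (Y \<inter> {n-m+r..n})) \<le> m - r + 1"
  proof (cases "r = m + 1")
    case False
    then have "r + n \<notin> X + Y" using rin by auto
    then show ?thesis using card_add_card_le_of_not_sum[OF finX finY, of "r+n" r m] rb
      by (simp add: algebra_simps)
  qed simp
  have 3: "int (card X) \<le> int (card (X \<inter> {0..k})) + (r - k - 1) + int (card (X \<inter> {r..m}))"
    by (rule card_split3[OF finX XI]) (use kr in simp)
  have 4: "int (card Y) \<le> int (card (Y \<inter> {0..k})) + (n-m+r - k - 1) + int (card (Y \<inter> {n-m+r..n}))"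
    by (rule card_split3[OF finY YI]) (use kr mn in simp)
  have len: "int (card X) + int (card Y) \<le> r + n - k" using 1 2 3 4 by linarith
  have "{k+1..k+1 + int (card X) + int (card Y) - 2} \<subseteq> X + Y"
  proof
    fix i assume "i \<in> {k+1..k+1 + int (card X) + int (card Y) - 2}"
    then have i: "k < i" "i < r + n" using len by auto
    consider "i \<le> m" | "m \<le> i" "i \<le> n" | "n < i" by linarith
    then show "i \<in> X + Y"
    proof cases
      case 1 then show ?thesis using kmax i kb by simp
    next
      case 2 then show ?thesis by (rule sum_contains_middle)
    next
      case 3 then show ?thesis using rmin[of "i - n"] i rb by simp
    qed
  qed
  then show ?thesis by blast
qed

end

section \<open>Freiman's theorem for integers\<close>

text \<open>The multiples of \<open>Gcd A\<close> in \<open>B\<close> and the other elements of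
  \<open>B\<close> have disjoint sumsets with \<open>A\<close>, so the trivial lower bound applies
  to each piece separately.\<close>

lemma card_sumset_residues_split:
  fixes A B :: "int set"
  assumes "finite A" "finite B" "A \<subseteq> B" "A \<noteq> {}" "Gcd A \<noteq> 1" "Gcd B = 1"
  shows "2 * card A + card B \<le> card (A + B) + 2"
proof -
  define d where "d = Gcd A"
  define B0 where "B0 = {b \<in> B. d dvd b}"
  define B1 where "B1 = {b \<in> B. \<not> d dvd b}"
  have dA: "d dvd a" if "a \<in> A" for a using that unfolding d_def by simp
  have fin: "finite B0" "finite B1" using assms(2) by (auto simp: B0_def B1_def)
  have "B1 \<noteq> {}"
  proof
    assume "B1 = {}"
    then have "d dvd Gcd B" by (intro Gcd_greatest) (auto simp: B1_def)
    then show False using assms(5,6) by (simp add: d_def)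
  qed
  moreover have "B0 \<noteq> {}" using assms(3,4) dA by (auto simp: B0_def)
  ultimately have 1: "card A + card B0 \<le> card (A + B0) + 1" "card A + card B1 \<le> card (A + B1) + 1"
    using card_set_plus_ge[of A B0] card_set_plus_ge[of A B1] assms(1,4) fin by auto
  have "B = B0 \<union> B1" "B0 \<inter> B1 = {}" by (auto simp: B0_def B1_def)
  then have 2: "card B = card B0 + card B1" using fin by (simp add: card_Un_disjoint)
  have "d dvd w" if "w \<in> A + B0" for w
    using that dA by (auto elim!: set_plus_elim simp: B0_def)
  moreover have "\<not> d dvd w" if "w \<in> A + B1" for w
    using that dA by (auto elim!: set_plus_elim simp: B1_def dvd_add_right_iff)
  ultimately have "(A + B0) \<inter> (A + B1) = {}" by blast
  then have "card (A + B0) + card (A + B1) = card ((A + B0) \<union> (A + B1))"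
    using assms(1) fin by (simp add: card_Un_disjoint finite_set_plus)
  also have "\<dots> \<le> card (A + B)"
    using assms(1,2) by (intro card_mono finite_set_plus Un_least set_plus_mono2) (auto simp: B0_def B1_def)
  finally show ?thesis using 1 2 by linarith
qed

text \<open>The equality case of \<open>|A + B| \<ge> |A + A| + |B|\<close> for \<open>A\<close> to the left of \<open>B\<close>: comparing the sums next
  to \<open>2 max A\<close> shows that \<open>max A\<close> has neighbours at equal distance \<open>w - v\<close> on both sides, and an extremal
  element outside the residue class of \<open>v\<close> would produce an additional sum.\<close>
lemma sumset_exact_gap_dvd:
  fixes A B :: "int set" and v w :: int
  assumes fin: "finite A" "finite B"
    and v: "v \<in> A" "\<And>a. a \<in> A \<Longrightarrow> a \<le> v" "A \<noteq> {v}"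
    and w: "w \<in> B" "\<And>b. b \<in> B \<Longrightarrow> w \<le> b" "v < w"
    and exact: "A + B \<subseteq> (A + A) \<union> (\<lambda>b. v + b) ` B"
  shows "\<forall>c \<in> A \<union> B. w - v dvd c - v"
proof -
  define v' where "v' = Max (A - {v})"
  have ne: "A - {v} \<noteq> {}" using v by auto
  have v'in: "v' \<in> A - {v}" unfolding v'_def using fin ne by (intro Max_in) auto
  have v'max: "a \<le> v'" if "a \<in> A" "a \<noteq> v" for a unfolding v'_def using fin that by (intro Max_ge) auto
  have v'v: "v' < v" using v'in v(2)[of v'] by auto
  have AA: "s = v + v" if s: "s \<in> A + A" "v' + v < s" for s
  proof -
    obtain b c where bc: "s = b + c" "b \<in> A" "c \<in> A" using s(1) by (rule set_plus_elim)
    show ?thesis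
    proof (cases "b = v \<and> c = v")
      case False
      then have "b \<le> v' \<or> c \<le> v'" using v'max bc by blast
      then show ?thesis using bc s(2) v(2)[of b] v(2)[of c] by auto
    qed (use bc in simp)
  qed
  have "v' + w \<in> A + B" using v'in w(1) by (auto intro: set_plus_intro)
  then have "v' + w \<in> A + A" using exact w(2) v'v by fastforce
  then have g: "v' + w = v + v" by (rule AA) (use w(3) in simp)
  have B: "w - v dvd b - v" if "b \<in> B" for b
  proof (rule ccontr)
    assume bad: "\<not> w - v dvd b - v"
    define b0 where "b0 = Min {b \<in> B. \<not> w - v dvd b - v}"
    have b0: "b0 \<in> {b \<in> B. \<not> w - v dvd b - v}" unfolding b0_def using fin that bad by (intro Min_in) auto
    have b0min: "w - v dvd b - v" if "b \<in> B" "b < b0" for b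
    proof (rule ccontr)
      assume "\<not> w - v dvd b - v"
      then have "b0 \<le> b" unfolding b0_def using fin that by (intro Min_le) auto
      then show False using that by simp
    qed
    have "v' + b0 \<in> A + B" using v'in b0 by (auto intro: set_plus_intro)
    then consider "v' + b0 \<in> A + A" | b where "b \<in> B" "v' + b0 = v + b" using exact by blast
    then show False
    proof cases
      case 1
      then have "v' + b0 = v + v" using AA[of "v' + b0"] b0 w(2)[of b0] w(3) by simp
      then have "b0 = w" using g by linarith
      then show False using b0 by simp
    next
      case 2
      then have "w - v dvd b - v" using b0min[of b] v'v by simp
      then have "w - v dvd (b - v) + (w - v)" by (rule dvd_add[OF _ dvd_refl])
      moreover have "(b - v) + (w - v) = b0 - v" using 2 g by simp
      ultimately show False using b0 by simp
    qed
  qed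
  have A: "w - v dvd a - v" if "a \<in> A" for a
  proof (rule ccontr)
    assume bad: "\<not> w - v dvd a - v"
    define a0 where "a0 = Max {a \<in> A. \<not> w - v dvd a - v}"
    have a0: "a0 \<in> {a \<in> A. \<not> w - v dvd a - v}" unfolding a0_def using fin that bad by (intro Max_in) auto
    have a0max: "w - v dvd a - v" if "a \<in> A" "a0 < a" for a
    proof (rule ccontr)
      assume "\<not> w - v dvd a - v"
      then have "a \<le> a0" unfolding a0_def using fin that by (intro Max_ge) auto
      then show False using that by simp
    qed
    have "a0 \<noteq> v" using a0 by auto
    then have "a0 < v" using v(2)[of a0] a0 by auto
    have "a0 + w \<in> A + B" using w(1) a0 by (auto intro: set_plus_intro)
    moreover have "a0 + w \<notin> (\<lambda>b. v + b) ` B" using w(2) \<open>a0 < v\<close> by fastforce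
    ultimately have "a0 + w \<in> A + A" using exact by blast
    then obtain b c where bc: "a0 + w = b + c" "b \<in> A" "c \<in> A" by (rule set_plus_elim)
    have "w - v dvd b - v" "w - v dvd c - v"
      using a0max[of b] a0max[of c] bc v(2)[of b] v(2)[of c] w(3) by auto
    then have "w - v dvd (b - v) + (c - v) - (w - v)" by (rule dvd_diff[OF dvd_add dvd_refl])
    moreover have "(b - v) + (c - v) - (w - v) = a0 - v" using bc by simp
    ultimately show False using a0 by simp
  qed
  show ?thesis using A B by blast
qed

text \<open>Modulo \<open>z\<close> both \<open>A\<close> and \<open>z + A\<close> reduce to
  \<open>A\<close>, whereas the \<open>2 |A| - 1\<close> integers of the interval are pairwise
  incongruent. Hence at most \<open>|A|\<close> of them lie in \<open>P\<close>, which has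
  \<open>2 |A|\<close> elements, and at least \<open>|A| - 1\<close> are new.\<close>

lemma card_sumset_with_far_element:
  fixes A :: "int set" and v z u :: int
  assumes "finite A" "A \<subseteq> {0..v}" "v < z" "0 \<in> A"
    and J: "{u..u + 2 * int (card A) - 2} \<subseteq> A + A" and z: "2 * int (card A) \<le> z + 1"
  shows "3 * card A \<le> card ((A + A) \<union> (\<lambda>a. z + a) ` A) + 1"
proof -
  define I where "I = {u..u + 2 * int (card A) - 2}"
  define P where "P = A \<union> (\<lambda>a. z + a) ` A"
  have "(\<lambda>i. i mod z) ` (I \<inter> P) \<subseteq> A"
    using assms(2,3) by (force simp: P_def)
  moreover have "inj_on (\<lambda>i. i mod z) I"
  proof (rule inj_onI)
    fix i j assume ij: "i \<in> I" "j \<in> I" "i mod z = j mod z"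
    then have "z dvd i - j" by (simp add: mod_eq_dvd_iff)
    moreover have "\<bar>i - j\<bar> < z" using ij z by (auto simp: I_def)
    ultimately show "i = j" using zdvd_imp_le[of z "\<bar>i - j\<bar>"] by fastforce
  qed
  ultimately have "card (I \<inter> P) \<le> card A"
    using assms(1) by (metis card_inj_on_le inf_le1 inj_on_subset)
  moreover have "finite I" "finite P" using assms(1) by (auto simp: I_def P_def)
  moreover have "card I + 1 = 2 * card A"
  proof -
    have "1 \<le> card A" using assms(1,4) by (auto simp: card_gt_0_iff Suc_le_eq)
    then show ?thesis unfolding I_def card_atLeastAtMost_int by linarith
  qed
  ultimately have 1: "card A \<le> card (I - P) + 1"
    using card_Diff_subset_Int[of I P] by (simp add: diff_le_self)
  have "z + a \<notin> A" if "a \<in> A" for a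
  proof
    assume "z + a \<in> A"
    then have "z + a \<le> v" "0 \<le> a" using that assms(2) by auto
    then show False using assms(3) by simp
  qed
  then have "card P = card A + card ((\<lambda>a. z + a) ` A)"
    unfolding P_def using assms(1) by (intro card_Un_disjoint) auto
  also have "card ((\<lambda>a. z + a) ` A) = card A" by (intro card_image inj_onI) simp
  finally have 2: "card P = 2 * card A" by simp
  have "A \<subseteq> A + A" using set_plus_intro[of _ A 0 A] assms(4) by fastforce
  then have "(I - P) \<union> P \<subseteq> (A + A) \<union> (\<lambda>a. z + a) ` A" using J by (auto simp: I_def P_def)
  then have "card ((I - P) \<union> P) \<le> card ((A + A) \<union> (\<lambda>a. z + a) ` A)"
    using assms(1) by (intro card_mono) (simp add: finite_set_plus)
  moreover have "card ((I - P) \<union> P) = card (I - P) + card P"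
    using \<open>finite I\<close> \<open>finite P\<close> by (intro card_Un_disjoint) auto
  ultimately show ?thesis using 1 2 by linarith
qed

lemma dense_symmetric:
  fixes A :: "int set"
  assumes "finite A" "A \<subseteq> {0..m}" "0 \<in> A" "m \<in> A" "m + 3 \<le> 2 * int (card A)"
  shows "m + int (card A) \<le> int (card (A + A))"
    and "card (A + A) + 4 \<le> 3 * card A \<Longrightarrow> \<exists>u. {u..u + 2 * int (card A) - 2} \<subseteq> A + A"
proof -
  have "0 \<le> m" using assms by auto
  show "m + int (card A) \<le> int (card (A + A))"
    using card_sum_ge_span[where X = A and Y = A and m = m and n = m] assms \<open>0 \<le> m\<close> by simp
  assume "card (A + A) + 4 \<le> 3 * card A"
  then have "\<exists>u. {u..u + int (card A) + int (card A) - 2} \<subseteq> A + A"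
    using sum_contains_interval[where X = A and Y = A and m = m and n = m] assms \<open>0 \<le> m\<close> by simp
  then show "\<exists>u. {u..u + 2 * int (card A) - 2} \<subseteq> A + A" by (simp add: algebra_simps)
qed

text \<open>\<open>B\<close> is the shortest final piece of \<open>A\<close> of density at most one half and \<open>D\<close> is the rest. By minimality
  the last \<open>j = 2|B| - 1\<close> integers up to \<open>2m\<close> are all sums, so it remains to find
  \<open>3|D| + |B| - 2\<close> sums in \<open>D + A\<close>.\<close>
lemma card_sumset_sparse:
  fixes A :: "int set"
  assumes "finite A" "A \<subseteq> {0..m}" "0 \<in> A" "m \<in> A" "Gcd A = 1" "2 * int (card A) \<le> m + 2"
  shows "3 * card A \<le> card (A + A) + 3"
  using assms
proof (induction "card A" arbitrary: A m rule: less_induct)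
  case less
  note finA = less.prems(1) and AI = less.prems(2) and A0 = less.prems(3) and Am = less.prems(4)
    and gcdA = less.prems(5) and sparse = less.prems(6)
  define a where "a i = int (card (A \<inter> {m-i..m}))" for i
  have m0: "0 < m"
  proof (rule ccontr)
    assume "\<not> 0 < m"
    then have "A = {0}" using A0 AI by auto
    then show False using gcdA by simp
  qed
  then have "card {0, m} \<le> card A" using A0 Am finA by (intro card_mono) auto
  then have m2: "2 \<le> m" using m0 sparse by simp
  \<comment> \<open>The minimum exists and is at most \<open>m - 1\<close>: the window
    \<open>{1..m}\<close> holds all of \<open>A\<close> except \<open>0\<close>.\<close>
  define j where "j = int (LEAST i. 1 \<le> i \<and> 2 * a (int i) \<le> int i + 1)"
  have "A - {0} = A \<inter> {m - (m - 1)..m}" using AI by auto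
  then have "a (m - 1) = int (card A) - 1" using A0 finA
    by (simp add: a_def card_gt_0_iff) (metis Suc_leI card_Diff_singleton card_gt_0_iff empty_iff of_nat_1 of_nat_diff One_nat_def)
  then have "1 \<le> nat (m - 1) \<and> 2 * a (int (nat (m - 1))) \<le> int (nat (m - 1)) + 1"
    using m2 sparse by simp
  from LeastI[of "\<lambda>i. 1 \<le> i \<and> 2 * a (int i) \<le> int i + 1", OF this]
    Least_le[of "\<lambda>i. 1 \<le> i \<and> 2 * a (int i) \<le> int i + 1", OF this]
  have j: "1 \<le> j" "2 * a j \<le> j + 1" "j \<le> m - 1" unfolding j_def by linarith+
  have jmin: "i + 2 \<le> 2 * a i" if "0 \<le> i" "i < j" for i
  proof (cases "i = 0")
    case True
    have "A \<inter> {m..m} = {m}" using Am by auto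
    then show ?thesis using True by (simp add: a_def)
  next
    case False
    then have "\<not> (1 \<le> nat i \<and> 2 * a (int (nat i)) \<le> int (nat i) + 1)"
      using that unfolding j_def by (intro not_less_Least) linarith
    then show ?thesis using False that by auto
  qed
  have top: "{2*m-j+1..2*m} \<subseteq> A + A"
  proof
    fix k assume k: "k \<in> {2*m-j+1..2*m}"
    show "k \<in> A + A"
    proof (rule ccontr)
      \<comment> \<open>With \<open>k = 2m - i\<close> missing, reflection maps the window
        \<open>{m-i..m}\<close> to itself and leaves it at most half full, against
        \<open>jmin\<close>.\<close>
      assume "k \<notin> A + A"
      then have "int (card (A \<inter> {k-m..m})) + int (card (A \<inter> {k-m..k-(k-m)})) \<le> m - (k-m) + 1"
        using k finA j by (intro card_add_card_le_of_not_sum) auto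
      then show False using jmin[of "2*m-k"] k by (simp add: a_def)
    qed
  qed
  define B where "B = A \<inter> {m-j..m}"
  define D where "D = A \<inter> {0..m-j-1}"
  \<comment> \<open>Minimality at \<open>j - 1\<close> squeezes the count to equality, so the left
    end \<open>m - j\<close> of the window is vacant. This makes the gap \<open>w - v\<close> at
    least \<open>2\<close>.\<close>
  have cB: "2 * int (card B) = j + 1" and "m - j \<notin> A"
  proof -
    have sub: "A \<inter> {m-(j-1)..m} \<subseteq> B" by (auto simp: B_def)
    then have "a (j - 1) \<le> int (card B)" unfolding a_def using finA by (simp add: B_def card_mono)
    then show c: "2 * int (card B) = j + 1" using j jmin[of "j-1"] by (simp add: a_def B_def)
    have "card (A \<inter> {m-(j-1)..m}) = card B"
      using jmin[of "j-1"] j c card_mono[OF _ sub] finA by (simp add: a_def B_def)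
    then have "A \<inter> {m-(j-1)..m} = B" using sub finA by (intro card_subset_eq) (auto simp: B_def)
    then have "m - j \<notin> B" by force
    then show "m - j \<notin> A" using j by (simp add: B_def)
  qed
  have D0: "0 \<in> D" using A0 j by (simp add: D_def)
  have ADB: "A = D \<union> B" "D \<inter> B = {}" using AI by (auto simp: D_def B_def)
  have finD: "finite D" "finite B" using finA by (auto simp: D_def B_def)
  have cA: "card A = card D + card B" using ADB finD by (simp add: card_Un_disjoint)
  have Bne: "B \<noteq> {}" using cB j by auto
  define v where "v = Max D"
  define w where "w = Min B"
  have v: "v \<in> D" "\<And>a. a \<in> D \<Longrightarrow> a \<le> v" unfolding v_def using finD D0 by (auto intro: Max_in)
  have w: "w \<in> B" "\<And>b. b \<in> B \<Longrightarrow> w \<le> b" unfolding w_def using finD Bne by (auto intro: Min_in)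
  have wm: "m - j + 1 \<le> w" using w(1) \<open>m - j \<notin> A\<close> by (cases "w = m - j") (auto simp: B_def)
  have vm: "v \<le> m - j - 1" using v(1) by (auto simp: D_def)
  have vw: "v < w" using wm vm by linarith
  have DI: "D \<subseteq> {0..v}" using v by (auto simp: D_def)
  have finS: "finite (D + A)" "finite (D + D)" "finite (A + A)" using finA finD by (auto simp: finite_set_plus)
  have DDA: "D + D \<subseteq> D + A" and DBA: "D + B \<subseteq> D + A"
    using ADB by (auto intro: set_plus_mono2[THEN subsetD])
  have vBA: "(\<lambda>b. v + b) ` B \<subseteq> D + A" using v(1) ADB by (auto intro: set_plus_intro)
  have cvB: "card ((\<lambda>b. v + b) ` B) = card B" by (intro card_image inj_onI) simp
  have DD_le: "s \<le> v + v" if "s \<in> D + D" for s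
    using that
  proof (rule set_plus_elim)
    fix b c assume "s = b + c" "b \<in> D" "c \<in> D"
    then show "s \<le> v + v" using v(2)[of b] v(2)[of c] by simp
  qed
  show ?case
  proof (rule ccontr)
    assume contra: "\<not> ?case"
    have "{2*m-j+1..2*m} \<union> (D + A) \<subseteq> A + A" using top ADB by (auto intro: set_plus_mono2[THEN subsetD])
    then have "card ({2*m-j+1..2*m} \<union> (D + A)) \<le> card (A + A)" using finS by (intro card_mono)
    moreover have "s \<le> v + m" if "s \<in> D + A" for s
      using that v(2) AI by (auto elim!: set_plus_elim intro!: add_mono)
    then have "card ({2*m-j+1..2*m} \<union> (D + A)) = card {2*m-j+1..2*m} + card (D + A)"
      using finS vm by (intro card_Un_disjoint) fastforce+
    ultimately have "j + int (card (D + A)) \<le> int (card (A + A))" using j by simp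
    then have small: "card (D + A) + 3 \<le> 3 * card D + card B" using contra cA cB by linarith
    have gcdD: "Gcd D = 1"
    proof (rule ccontr)
      assume "Gcd D \<noteq> 1"
      then have "2 * card D + card A \<le> card (D + A) + 2"
        using ADB D0 finA finD gcdA by (intro card_sumset_residues_split) auto
      then show False using small cA by linarith
    qed
    have vB_disj: "(D + D) \<inter> (\<lambda>b. v + b) ` B = {}" using DD_le w(2) wm vm by fastforce
    \<comment> \<open>Otherwise \<open>D + D\<close> and \<open>v + B\<close> already exhaust
      \<open>D + A\<close>. The equality case then makes \<open>w - v \<ge> 2\<close> divide every
      element of \<open>A\<close>, contrary to \<open>Gcd A = 1\<close>.\<close>
    have "\<not> 3 * card D \<le> card (D + D) + 3"
    proof
      assume "3 * card D \<le> card (D + D) + 3"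
      moreover have "card ((D + D) \<union> (\<lambda>b. v + b) ` B) = card (D + D) + card B"
        using finS finD vB_disj cvB by (subst card_Un_disjoint) auto
      ultimately have "card (D + A) \<le> card ((D + D) \<union> (\<lambda>b. v + b) ` B)" using small by linarith
      then have "(D + D) \<union> (\<lambda>b. v + b) ` B = D + A"
        using finS DDA vBA by (intro card_seteq) auto
      then have "D + B \<subseteq> (D + D) \<union> (\<lambda>b. v + b) ` B" using DBA by simp
      moreover have "D \<noteq> {v}" using gcdD D0 by auto
      ultimately have "\<forall>c \<in> D \<union> B. w - v dvd c - v"
        by (intro sumset_exact_gap_dvd[OF finD v(1) _ _ w(1)]) (use v w vw in blast)+
      then have *: "\<forall>c \<in> A. w - v dvd c - v" using ADB by simp
      then have "w - v dvd v" using A0 by fastforce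
      then have "\<forall>c \<in> A. w - v dvd c" using * by (metis diff_add_cancel dvd_add)
      then have "w - v dvd Gcd A" by (intro Gcd_greatest) auto
      then show False using gcdA wm vm by auto
    qed
    then have DD: "card (D + D) + 4 \<le> 3 * card D" by linarith
    have "card D < card A" using cA cB j by linarith
    \<comment> \<open>By the induction hypothesis a sparse \<open>D\<close> would violate
      \<open>DD\<close>.\<close>
    then have dense: "v + 3 \<le> 2 * int (card D)"
      using less.hyps[of D v] finD DI D0 v(1) gcdD DD by linarith
    obtain u where u: "{u..u + 2 * int (card D) - 2} \<subseteq> D + D"
      using dense_symmetric(2)[OF finD(1) DI D0 v(1) dense DD] by blast
    have 1: "3 * card D \<le> card ((D + D) \<union> (\<lambda>a. w + a) ` D) + 1"
      by (rule card_sumset_with_far_element[OF finD(1) DI _ D0 u]) (use wm vm sparse cA cB in auto)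
    \<comment> \<open>\<open>w\<close> is left out because \<open>v + w\<close> already occurs in
      \<open>w + D\<close>. The rest of \<open>v + B\<close> lies strictly above, and the total is
      \<open>3 |D| + |B| - 2\<close>, contradicting \<open>small\<close>.\<close>
    define R where "R = (\<lambda>b. v + b) ` (B - {w})"
    have "card R = card B - 1" unfolding R_def using finD w(1) by (subst card_image) (auto intro: inj_onI)
    moreover have "s \<le> v + w" if "s \<in> (D + D) \<union> (\<lambda>a. w + a) ` D" for s
      using that DD_le[of s] v(2) wm vm by fastforce
    then have "card ((D + D) \<union> (\<lambda>a. w + a) ` D) + card R = card ((D + D) \<union> (\<lambda>a. w + a) ` D \<union> R)"
      using finS finD w(2) by (intro card_Un_disjoint[symmetric]) (force simp: R_def)+
    moreover have "(\<lambda>a. w + a) ` D \<subseteq> D + A"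
      using w(1) ADB by (auto intro!: set_plus_intro simp: add.commute[of w])
    then have "card ((D + D) \<union> (\<lambda>a. w + a) ` D \<union> R) \<le> card (D + A)"
      using finS DDA vBA by (intro card_mono) (auto simp: R_def)
    ultimately show False using 1 small Bne finD(2) by (simp add: card_gt_0_iff Suc_le_eq)
  qed
qed

text \<open>Small doubling excludes the sparse case by \<open>card_sumset_sparse\<close>; in the
  dense case the counting results for two sets apply with both sets equal to
  \<open>A\<close>.\<close>

theorem freiman_3k4:
  fixes A :: "int set"
  assumes "finite A" "A \<subseteq> {0..m}" "0 \<in> A" "m \<in> A" "Gcd A = 1" "card (A + A) + 4 \<le> 3 * card A"
  shows "m + int (card A) \<le> int (card (A + A))"
    and "\<exists>u. {u..u + 2 * int (card A) - 2} \<subseteq> A + A"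
proof -
  have d: "m + 3 \<le> 2 * int (card A)"
    using card_sumset_sparse[OF assms(1-5)] assms(6) by linarith
  show "m + int (card A) \<le> int (card (A + A))" "\<exists>u. {u..u + 2 * int (card A) - 2} \<subseteq> A + A"
    using dense_symmetric[OF assms(1-4) d] assms(6) by blast+
qed

section \<open>Points in a half plane\<close>

text \<open>The two multipliers are unit vectors at angles plus and minus \<open>arcsin s\<close>.
  Both half planes contain \<open>z\<close> when \<open>Re z \<ge> s\<close>, at least one does when
  \<open>|Re z| < s\<close>, and for \<open>Re z \<le> - s\<close> the left side is
  \<open>0\<close>.\<close>

lemma half_plane_balance:
  fixes z :: complex and s :: real
  assumes "norm z = 1" "0 < s" "s \<le> 1"
  defines "\<sigma> \<equiv> sqrt (1 - s\<^sup>2)"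
  shows "of_bool (s \<le> Re z) - of_bool (Re z \<le> - s) + (1::real)
       \<le> of_bool (0 \<le> Re (z * Complex \<sigma> s)) + of_bool (0 \<le> Re (z * Complex \<sigma> (-s)))"
proof -
  obtain x y where z: "z = Complex x y" by (cases z)
  have xy: "x\<^sup>2 + y\<^sup>2 = 1" using assms(1) by (simp add: z cmod_def)
  have s1: "s\<^sup>2 \<le> 1" using assms(2,3) by (simp add: power_le_one)
  have sg: "0 \<le> \<sigma>" "\<sigma>\<^sup>2 = 1 - s\<^sup>2" using s1 by (auto simp: \<sigma>_def)
  have A: "s * \<bar>y\<bar> \<le> x * \<sigma>" if "s \<le> x"
  proof -
    have "s\<^sup>2 \<le> x\<^sup>2" using that assms(2) by (simp add: power_mono)
    then have "\<bar>y\<bar>\<^sup>2 \<le> \<sigma>\<^sup>2" using xy sg by simp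
    then have "\<bar>y\<bar> \<le> \<sigma>" using sg(1) by (rule power2_le_imp_le)
    then show ?thesis using that assms(2) sg(1) by (intro mult_mono) auto
  qed
  have B: "- x * \<sigma> \<le> s * \<bar>y\<bar>" if "- s < x" "x < s"
  proof -
    have "x\<^sup>2 \<le> s\<^sup>2" using that by (intro power2_le_iff_abs_le[THEN iffD2]) auto
    then have "\<sigma>\<^sup>2 \<le> \<bar>y\<bar>\<^sup>2" using xy sg by simp
    then have "\<sigma> \<le> \<bar>y\<bar>" by (rule power2_le_imp_le) simp
    then have "\<bar>x\<bar> * \<sigma> \<le> s * \<bar>y\<bar>" using that sg(1) by (intro mult_mono) auto
    moreover have "- x * \<sigma> \<le> \<bar>x\<bar> * \<sigma>" using sg(1) by (intro mult_right_mono) auto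
    ultimately show ?thesis by linarith
  qed
  have sy: "s * \<bar>y\<bar> = y * s \<or> s * \<bar>y\<bar> = - (y * s)" by (auto simp: abs_if)
  have sy2: "y * s \<le> s * \<bar>y\<bar>" "- (y * s) \<le> s * \<bar>y\<bar>"
    using assms(2) by (auto simp: abs_if mult.commute mult_le_0_iff zero_le_mult_iff)
  consider "s \<le> x" | "- s < x" "x < s" | "x \<le> - s" by linarith
  then show ?thesis
  proof cases
    case 1
    then have "y * s \<le> x * \<sigma>" "0 \<le> x * \<sigma> + y * s" using A sy2 by linarith+
    then show ?thesis using 1 assms(2) by (simp add: z)
  next
    case 2
    then have "0 \<le> x * \<sigma> + y * s \<or> 0 \<le> x * \<sigma> - y * s" using B sy by linarith
    then show ?thesis using 2 by (auto simp: z)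
  next
    case 3 then show ?thesis using assms(2) by (auto simp: z)
  qed
qed

text \<open>Rotate so that \<open>S = \<Sum> z\<close> is real and write each real part as the integral over the thresholds
  \<open>s \<in> (0, 1]\<close> of the difference of indicators bounded in the preceding lemma.\<close>
lemma closed_half_plane_exists:
  fixes z :: "'a \<Rightarrow> complex"
  assumes "finite J" "\<And>j. j \<in> J \<Longrightarrow> norm (z j) = 1"
  shows "\<exists>u. norm u = 1 \<and> real (card J) + norm (\<Sum>j\<in>J. z j) \<le> 2 * real (card {j \<in> J. 0 \<le> Re (z j * u)})"
proof -
  define S where "S = (\<Sum>j\<in>J. z j)"
  define w where "w = (if S = 0 then 1 else cnj S / norm S)"
  have w1: "norm w = 1" by (simp add: w_def norm_divide)
  have Sw: "Re (S * w) = norm S"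
  proof (cases "S = 0")
    case False
    have "S * w = S * cnj S / norm S" using False by (simp add: w_def)
    also have "\<dots> = complex_of_real ((norm S)\<^sup>2) / complex_of_real (norm S)" by (simp only: complex_norm_square)
    also have "\<dots> = of_real (norm S)" using False by (simp add: power2_eq_square)
    finally show ?thesis by simp
  qed simp
  define q where "q u = real (card {j \<in> J. 0 \<le> Re (z j * u)})" for u
  have qb: "q u \<le> card J" for u unfolding q_def using assms(1) by (auto intro!: card_mono)
  show ?thesis
  proof (rule ccontr)
    assume "\<not> ?thesis"
    then have lt: "2 * q u < card J + norm S" if "norm u = 1" for u
      using that unfolding q_def S_def by force
    have fin: "finite (q ` {u. norm u = 1})"
    proof (rule finite_subset)
      show "q ` {u. norm u = 1} \<subseteq> real ` {..card J}"
        using qb by (auto simp: q_def)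
    qed simp
    \<comment> \<open>Since \<open>q\<close> takes finitely many values, the maximum is attained;
      the strict failure assumed for each \<open>u\<close> becomes uniform and survives
      integration.\<close>
    define Q where "Q = Max (q ` {u. norm u = 1})"
    have "Q \<in> q ` {u. norm u = 1}" unfolding Q_def using fin w1 by (intro Max_in) auto
    then have Q: "2 * Q < card J + norm S" using lt by auto
    have qQ: "q u \<le> Q" if "norm u = 1" for u unfolding Q_def using fin that by (intro Max_ge) auto
    define f where "f j s = of_bool (s \<le> Re (z j * w)) - (of_bool (Re (z j * w) \<le> - s) :: real)" for j s
    have bound: "(\<Sum>j\<in>J. f j s) \<le> 2 * Q - card J" if "s \<in> {0<..1}" for s
    proof -
      let ?u = "Complex (sqrt (1 - s\<^sup>2)) s" and ?v = "Complex (sqrt (1 - s\<^sup>2)) (-s)"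
      have s1: "s\<^sup>2 \<le> 1" using that by (simp add: power_le_one)
      then have n: "norm ?u = 1" "norm ?v = 1" by (simp_all add: cmod_def)
      have "(\<Sum>j\<in>J. f j s + 1) \<le> (\<Sum>j\<in>J. of_bool (0 \<le> Re (z j * (w * ?u))) + of_bool (0 \<le> Re (z j * (w * ?v))))"
      proof (rule sum_mono)
        fix j assume "j \<in> J"
        then have "norm (z j * w) = 1" using assms(2) w1 by (simp add: norm_mult)
        then show "f j s + 1 \<le> of_bool (0 \<le> Re (z j * (w * ?u))) + of_bool (0 \<le> Re (z j * (w * ?v)))"
          using half_plane_balance[of "z j * w" s] that unfolding f_def mult.assoc by simp
      qed
      also have "\<dots> = q (w * ?u) + q (w * ?v)"
        unfolding q_def sum.distrib using assms(1) by (simp only: sum_of_bool_eq Collect_conj_eq Collect_mem_eq)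
      also have "\<dots> \<le> 2 * Q"
        using qQ[of "w * ?u"] qQ[of "w * ?v"] n w1 by (simp add: norm_mult)
      finally show ?thesis by (simp add: sum.distrib)
    qed
    have int: "(f j has_integral Re (z j * w)) {0..1}" if "j \<in> J" for j
    proof -
      define x where "x = Re (z j * w)"
      have x1: "\<bar>x\<bar> \<le> 1" unfolding x_def
        using abs_Re_le_cmod[of "z j * w"] assms(2)[OF that] w1 by (simp add: norm_mult)
      have I: "((\<lambda>s. of_bool (s \<le> c) :: real) has_integral c) {0..1}" if "0 \<le> c" "c \<le> 1" for c :: real
      proof -
        have "((\<lambda>s. 1 :: real) has_integral c) {0..c}" using has_integral_const_real[of "1::real" 0 c] that by simp
        then have "((\<lambda>s. if s \<in> {0..c} then 1 else 0 :: real) has_integral c) {0..1}"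
          by (subst has_integral_restrict) (use that in auto)
        then show ?thesis by (rule has_integral_eq[rotated]) auto
      qed
      have I0: "((\<lambda>s. of_bool (s \<le> c) :: real) has_integral 0) {0..1}" if "c \<le> 0" for c :: real
        by (rule has_integral_spike_finite[of "{0}" _ _ "\<lambda>s. 0"]) (use that in auto)
      have e: "f j = (\<lambda>s. of_bool (s \<le> x) - of_bool (s \<le> - x))"
        by (intro ext) (simp only: f_def x_def[symmetric] le_minus_iff[of x])
      show ?thesis unfolding x_def[symmetric] e
      proof (cases "0 \<le> x")
        case True
        then show "((\<lambda>s. of_bool (s \<le> x) - of_bool (s \<le> - x)) has_integral x) {0..1}"
          using has_integral_diff[OF I[of x] I0[of "-x"]] x1 by simp
      next
        case False
        then show "((\<lambda>s. of_bool (s \<le> x) - of_bool (s \<le> - x)) has_integral x) {0..1}"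
          using has_integral_diff[OF I0[of x] I[of "-x"]] x1 by simp
      qed
    qed
    have "((\<lambda>s. \<Sum>j\<in>J. f j s) has_integral (\<Sum>j\<in>J. Re (z j * w))) {0..1}"
      using assms(1) int by (intro has_integral_sum) auto
    moreover have "(\<Sum>j\<in>J. Re (z j * w)) = Re (S * w)"
      unfolding S_def sum_distrib_right by (rule Re_sum[symmetric])
    ultimately have I1: "((\<lambda>s. \<Sum>j\<in>J. f j s) has_integral norm S) {0..1}" by (simp only: Sw)
    \<comment> \<open>The bound is available only for \<open>s > 0\<close>; changing the integrand
      at one point does not affect the integral.\<close>
    have "((\<lambda>s. if s = 0 then 2 * Q - card J else \<Sum>j\<in>J. f j s) has_integral norm S) {0..1}"
      by (rule has_integral_spike_finite[of "{0}", OF _ _ I1]) auto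
    moreover have "((\<lambda>s. 2 * Q - card J) has_integral 2 * Q - card J) {0..1::real}"
      using has_integral_const_real[of "2 * Q - card J" 0 1] by simp
    ultimately have "norm S \<le> 2 * Q - card J"
      by (rule has_integral_le) (use bound in auto)
    then show False using Q by simp
  qed
qed

section \<open>Sumsets modulo a prime\<close>

definition modsum :: "int \<Rightarrow> int set \<Rightarrow> int set \<Rightarrow> int set" where
  "modsum p A B = (\<lambda>x. x mod p) ` (A + B)"

lemma modsumI: "a \<in> A \<Longrightarrow> b \<in> B \<Longrightarrow> (a + b) mod p \<in> modsum p A B"
  unfolding modsum_def by (blast intro: set_plus_intro)

lemma modsumE:
  assumes "x \<in> modsum p A B"
  obtains a b where "x = (a + b) mod p" "a \<in> A" "b \<in> B"
  using assms unfolding modsum_def by (auto elim: set_plus_elim)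

lemma finite_modsum: "finite A \<Longrightarrow> finite B \<Longrightarrow> finite (modsum p A B)"
  by (simp add: modsum_def finite_set_plus)

lemma modsum_subset: "0 < p \<Longrightarrow> modsum p A B \<subseteq> {0..<p}"
  by (auto simp: modsum_def)

lemma inj_on_affine_mod:
  fixes d e u p :: int
  assumes "coprime d p"
  shows "inj_on (\<lambda>x. (d * x + e) mod p) {u..<u+p}"
proof (rule inj_onI)
  fix x y assume xy: "x \<in> {u..<u+p}" "y \<in> {u..<u+p}" "(d * x + e) mod p = (d * y + e) mod p"
  then have "p dvd d * (x - y)" by (simp add: mod_eq_dvd_iff algebra_simps)
  then have "p dvd x - y" using assms by (simp add: coprime_commute coprime_dvd_mult_right_iff)
  moreover have "\<bar>x - y\<bar> < p" using xy by auto
  ultimately show "x = y" using zdvd_imp_le[of p "\<bar>x - y\<bar>"] by fastforce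
qed

lemma inj_on_shift_mod: "inj_on (\<lambda>x. (x + e) mod p) {0..<p}" for p :: int
  using inj_on_affine_mod[of 1 p e 0] by simp

section \<open>The Cauchy-Davenport inequality\<close>

lemma shift_invariant_full:
  fixes p h :: int
  assumes "prime p" "A \<subseteq> {0..<p}" "A \<noteq> {}" "\<not> p dvd h" "\<And>a. a \<in> A \<Longrightarrow> (a + h) mod p \<in> A"
  shows "A = {0..<p}"
proof -
  obtain a where a: "a \<in> A" using assms(3) by blast
  have p0: "0 < p" using assms(1) by (simp add: prime_gt_0_int)
  have it: "(a + int j * h) mod p \<in> A" for j
  proof (induction j)
    case 0
    then show ?case using a assms(2) by auto
  next
    case (Suc j)
    then have "((a + int j * h) mod p + h) mod p \<in> A" by (rule assms(5))
    also have "((a + int j * h) mod p + h) mod p = (a + int (Suc j) * h) mod p"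
      by (subst mod_add_left_eq) (simp add: algebra_simps)
    finally show ?case .
  qed
  have "coprime h p" using prime_imp_coprime[OF assms(1,4)] by (rule coprime_commute[THEN iffD1])
  then obtain g where g: "[h * g = 1] (mod p)" using cong_solve_coprime_int by blast
  have "x \<in> A" if "x \<in> {0..<p}" for x
  proof -
    define j where "j = nat ((g * (x - a)) mod p)"
    have "[int j * h = (g * (x - a)) * h] (mod p)"
      using p0 by (simp add: j_def cong_def mod_mult_left_eq)
    also have "(g * (x - a)) * h = (h * g) * (x - a)" by simp
    also have "[(h * g) * (x - a) = 1 * (x - a)] (mod p)" using g by (rule cong_scalar_right)
    finally have "[a + int j * h = a + 1 * (x - a)] (mod p)" by (rule cong_add[OF cong_refl])
    then have "(a + int j * h) mod p = x" using that by (simp add: cong_def)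
    then show ?thesis using it[of j] by simp
  qed
  then show ?thesis using assms(2) by blast
qed

text \<open>Induction on \<open>|B|\<close> by an e-transform: elements of \<open>B\<close> whose
  translate by \<open>e\<close> falls outside \<open>A\<close> are removed from \<open>B\<close>,
  and their translates are added to \<open>A\<close>. This preserves \<open>|A| + |B|\<close> and
  does not enlarge the sumset.\<close>

lemma cauchy_davenport:
  fixes p :: int
  assumes "prime p" "A \<subseteq> {0..<p}" "B \<subseteq> {0..<p}" "A \<noteq> {}" "B \<noteq> {}"
  shows "min p (int (card A) + int (card B) - 1) \<le> int (card (modsum p A B))"
  using assms(2-5)
proof (induction "card B" arbitrary: A B rule: less_induct)
  case less
  have p0: "0 < p" using assms(1) by (simp add: prime_gt_0_int)
  have fin: "finite A" "finite B" using less.prems finite_subset by auto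
  have shift: "int (card A) \<le> int (card (modsum p A B))" if "b \<in> B" for b
  proof -
    have "card ((\<lambda>a. (a + b) mod p) ` A) = card A"
      using inj_on_subset[OF inj_on_shift_mod less.prems(1)] by (rule card_image)
    moreover have "(\<lambda>a. (a + b) mod p) ` A \<subseteq> modsum p A B" using that by (auto intro: modsumI)
    then have "card ((\<lambda>a. (a + b) mod p) ` A) \<le> card (modsum p A B)"
      using fin by (intro card_mono finite_modsum)
    ultimately show ?thesis by simp
  qed
  obtain b2 where b2: "b2 \<in> B" using less.prems(4) by blast
  consider "B = {b2}" | "A = {0..<p}" | b1 where "b1 \<in> B" "b1 \<noteq> b2" "A \<noteq> {0..<p}" using b2 by blast
  then show ?case
  proof cases
    case 1 then show ?thesis using shift[OF b2] by simp
  next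
    case 2 then show ?thesis using shift[OF b2] p0 by simp
  next
    case (3 b1)
    have "\<not> p dvd b1 - b2"
    proof
      assume "p dvd b1 - b2"
      moreover have "b1 \<in> {0..<p}" "b2 \<in> {0..<p}" using 3 b2 less.prems(2) by blast+
      then have "\<bar>b1 - b2\<bar> < p" by auto
      ultimately show False using 3 zdvd_imp_le[of p "\<bar>b1 - b2\<bar>"] by fastforce
    qed
    \<comment> \<open>A nonzero shift cannot preserve \<open>A\<close>, so some \<open>a\<close> is
      moved out of it. With \<open>e = a - b2\<close> the element \<open>b2\<close> survives, which
      keeps \<open>B'\<close> nonempty, while \<open>b1\<close> is dropped.\<close>
    then obtain a where a: "a \<in> A" "(a + (b1 - b2)) mod p \<notin> A"
      using shift_invariant_full[OF assms(1) less.prems(1,3)] 3 by blast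
    define e where "e = a - b2"
    define B' where "B' = {b \<in> B. (b + e) mod p \<in> A}"
    define A' where "A' = A \<union> (\<lambda>b. (b + e) mod p) ` (B - B')"
    have "(b2 + e) mod p = a" using a less.prems(1) by (auto simp: e_def)
    then have b2': "b2 \<in> B'" using a b2 by (simp add: B'_def)
    have "b1 \<notin> B'" using a by (simp add: B'_def e_def algebra_simps)
    then have "B' \<subset> B" using 3 by (auto simp: B'_def)
    then have lt: "card B' < card B" using fin by (intro psubset_card_mono)
    have sub: "A' \<subseteq> {0..<p}" "B' \<subseteq> {0..<p}" using less.prems p0 by (auto simp: A'_def B'_def)
    have "card A' = card A + card ((\<lambda>b. (b + e) mod p) ` (B - B'))"
      unfolding A'_def using fin by (intro card_Un_disjoint) (auto simp: B'_def)
    also have "card ((\<lambda>b. (b + e) mod p) ` (B - B')) = card (B - B')"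
      by (intro card_image inj_on_subset[OF inj_on_shift_mod]) (use less.prems in auto)
    also have "card (B - B') = card B - card B'"
      using fin by (intro card_Diff_subset) (auto simp: B'_def)
    finally have c: "card A' + card B' = card A + card B" using lt by simp
    have "modsum p A' B' \<subseteq> modsum p A B"
    proof
      fix x assume "x \<in> modsum p A' B'"
      then obtain y b' where x: "x = (y + b') mod p" "y \<in> A'" "b' \<in> B'" by (rule modsumE)
      show "x \<in> modsum p A B"
      proof (cases "y \<in> A")
        case True then show ?thesis using x by (auto simp: B'_def intro: modsumI)
      next
        case False
        then obtain b where b: "b \<in> B" "y = (b + e) mod p" using x by (auto simp: A'_def)
        \<comment> \<open>The shift is handed over from \<open>b\<close> to \<open>b'\<close>, whose
          translate lies in \<open>A\<close> by the choice of \<open>B'\<close>.\<close>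
        have "x = ((b' + e) mod p + b) mod p"
          unfolding x(1) b(2) by (simp only: mod_add_left_eq) (simp add: algebra_simps)
        then show ?thesis using b x by (auto simp: B'_def intro: modsumI)
      qed
    qed
    then have "card (modsum p A' B') \<le> card (modsum p A B)" using fin by (intro card_mono finite_modsum)
    moreover have "min p (int (card A') + int (card B') - 1) \<le> int (card (modsum p A' B'))"
      by (rule less.hyps[OF lt sub]) (use b2' less.prems in \<open>auto simp: A'_def\<close>)
    ultimately show ?thesis using c by linarith
  qed
qed

section \<open>Fourier coefficients\<close>

definition unity_root :: "nat \<Rightarrow> int \<Rightarrow> complex" where
  "unity_root p k = cis (2 * pi * real_of_int k / real p)"

definition fourier :: "nat \<Rightarrow> int set \<Rightarrow> nat \<Rightarrow> complex" where
  "fourier p A \<xi> = (\<Sum>a\<in>A. unity_root p (int \<xi> * a))"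

lemma unity_root_add: "unity_root p (k + l) = unity_root p k * unity_root p l"
  by (simp add: unity_root_def cis_mult algebra_simps add_divide_distrib)

lemma cnj_unity_root: "cnj (unity_root p k) = unity_root p (- k)"
  by (simp add: unity_root_def cis_cnj)

lemma norm_unity_root [simp]: "norm (unity_root p k) = 1"
  by (simp add: unity_root_def)

lemma unity_root_mult_nat: "unity_root p (int n * k) = unity_root p k ^ n"
  by (simp add: unity_root_def Complex.DeMoivre algebra_simps)

lemma unity_root_eq_1_iff:
  assumes "0 < p"
  shows "unity_root p k = 1 \<longleftrightarrow> int p dvd k"
proof
  assume "unity_root p k = 1"
  then have "cos (2 * pi * real_of_int k / real p) = 1"
    unfolding unity_root_def by (metis cis.sel(1) one_complex.sel(1))
  then obtain n :: int where "2 * pi * real_of_int k / real p = of_int n * 2 * pi"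
    using cos_one_2pi_int by auto
  then have "real_of_int k = real_of_int (n * int p)" using assms by (simp add: field_simps)
  then have "k = n * int p" by linarith
  then show "int p dvd k" by simp
next
  assume "int p dvd k"
  then obtain n where n: "k = int p * n" by blast
  have "2 * pi * real_of_int k / real p = 2 * pi * of_int n" using assms n by simp
  then show "unity_root p k = 1" unfolding unity_root_def by (simp add: cis_multiple_2pi)
qed

lemma sum_unity_root:
  assumes "0 < p"
  shows "(\<Sum>\<xi><p. unity_root p (int \<xi> * k)) = (if int p dvd k then of_nat p else 0)"
proof (cases "int p dvd k")
  case True
  then have "unity_root p k = 1" using assms unity_root_eq_1_iff by blast
  then show ?thesis using True by (simp add: unity_root_mult_nat)
next
  case False
  then have ne: "unity_root p k \<noteq> 1" using assms unity_root_eq_1_iff by blast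
  have "unity_root p k ^ p = 1"
    unfolding unity_root_mult_nat[symmetric] using assms unity_root_eq_1_iff[of p "int p * k"] by simp
  then show ?thesis using False geometric_sum[OF ne, of p] unfolding unity_root_mult_nat by simp
qed

lemma norm_fourier_sq:
  "complex_of_real ((norm (fourier p A \<xi>))\<^sup>2) = (\<Sum>q\<in>A\<times>A. unity_root p (int \<xi> * (fst q - snd q)))"
proof -
  have "complex_of_real ((norm (fourier p A \<xi>))\<^sup>2) = fourier p A \<xi> * cnj (fourier p A \<xi>)"
    by (rule complex_norm_square)
  also have "\<dots> = (\<Sum>a\<in>A. \<Sum>b\<in>A. unity_root p (int \<xi> * a) * unity_root p (- (int \<xi> * b)))"
    by (simp add: fourier_def cnj_unity_root sum_product)
  also have "\<dots> = (\<Sum>a\<in>A. \<Sum>b\<in>A. unity_root p (int \<xi> * (a - b)))"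
    by (simp add: unity_root_add[symmetric] right_diff_distrib)
  finally show ?thesis by (simp add: sum.cartesian_product split_def)
qed

lemma parseval:
  assumes "0 < p" "A \<subseteq> {0..<int p}"
  shows "(\<Sum>\<xi><p. (norm (fourier p A \<xi>))\<^sup>2) = real p * real (card A)"
proof -
  have fin: "finite A" using assms(2) finite_subset by blast
  have "complex_of_real (\<Sum>\<xi><p. (norm (fourier p A \<xi>))\<^sup>2)
      = (\<Sum>\<xi><p. \<Sum>q\<in>A\<times>A. unity_root p (int \<xi> * (fst q - snd q)))"
    unfolding of_real_sum norm_fourier_sq ..
  also have "\<dots> = (\<Sum>q\<in>A\<times>A. \<Sum>\<xi><p. unity_root p (int \<xi> * (fst q - snd q)))"
    by (rule sum.swap)
  also have "\<dots> = (\<Sum>q\<in>A\<times>A. if int p dvd fst q - snd q then of_nat p else 0)"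
    using assms(1) by (simp add: sum_unity_root)
  also have "\<dots> = (\<Sum>a\<in>A. \<Sum>b\<in>A. if int p dvd a - b then of_nat p else 0)"
    by (simp add: sum.cartesian_product split_def)
  also have "\<dots> = (\<Sum>a\<in>A. \<Sum>b\<in>A. if b = a then of_nat p else 0)"
  proof (intro sum.cong refl if_cong)
    fix a b assume ab: "a \<in> A" "b \<in> A"
    then have "a mod int p = a" "b mod int p = b" using assms(2) by auto
    then show "int p dvd a - b \<longleftrightarrow> b = a" by (metis mod_eq_dvd_iff)
  qed
  also have "\<dots> = complex_of_real (real p * real (card A))" using fin by simp
  finally show ?thesis by (simp only: of_real_eq_iff)
qed

text \<open>Both squared norms expand into sums over differences, and orthogonality of the
  characters keeps only the pairs whose differences cancel modulo \<open>p\<close>.\<close>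

lemma fourth_moment:
  assumes "0 < p" "finite A" "finite B"
  shows "(\<Sum>\<xi><p. (norm (fourier p A \<xi>))\<^sup>2 * (norm (fourier p B \<xi>))\<^sup>2)
    = real p * (\<Sum>q\<in>A\<times>A. real (card {r \<in> B\<times>B. int p dvd (fst q - snd q) + (fst r - snd r)}))"
proof -
  have "complex_of_real (\<Sum>\<xi><p. (norm (fourier p A \<xi>))\<^sup>2 * (norm (fourier p B \<xi>))\<^sup>2)
      = (\<Sum>\<xi><p. \<Sum>q\<in>A\<times>A. \<Sum>r\<in>B\<times>B. unity_root p (int \<xi> * ((fst q - snd q) + (fst r - snd r))))"
    unfolding of_real_sum of_real_mult norm_fourier_sq
    by (simp add: sum_product unity_root_add[symmetric] distrib_left)
  also have "\<dots> = (\<Sum>q\<in>A\<times>A. \<Sum>r\<in>B\<times>B. \<Sum>\<xi><p. unity_root p (int \<xi> * ((fst q - snd q) + (fst r - snd r))))"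
    by (subst sum.swap) (intro sum.cong refl sum.swap)
  also have "\<dots> = (\<Sum>q\<in>A\<times>A. \<Sum>r\<in>B\<times>B. if int p dvd (fst q - snd q) + (fst r - snd r) then of_nat p else 0)"
    using assms(1) by (simp add: sum_unity_root)
  also have "\<dots> = (\<Sum>q\<in>A\<times>A. of_nat (card {r \<in> B\<times>B. int p dvd (fst q - snd q) + (fst r - snd r)}) * of_nat p)"
    using assms(3) by (intro sum.cong refl) (simp add: sum.inter_filter[symmetric])
  also have "\<dots> = complex_of_real (real p * (\<Sum>q\<in>A\<times>A. real (card {r \<in> B\<times>B. int p dvd (fst q - snd q) + (fst r - snd r)})))"
    by (simp add: sum_distrib_left mult.commute)
  finally show ?thesis by (simp only: of_real_eq_iff)
qed

section \<open>Additive energy\<close>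

text \<open>Modulo \<open>p\<close> this is \<open>A \<inter> (A - h)\<close>; for reduced
  \<open>A\<close> its size is the number of representations of \<open>h\<close> as a difference in
  \<open>A\<close>.\<close>

definition shift_inter :: "int \<Rightarrow> int set \<Rightarrow> int \<Rightarrow> int set" where
  "shift_inter p A h = {y \<in> A. (y + h) mod p \<in> A}"

lemma card_differences:
  assumes "0 < p" "A \<subseteq> {0..<p}"
  shows "card {r \<in> A\<times>A. p dvd h + (fst r - snd r)} = card (shift_inter p A h)"
proof (rule bij_betw_same_card)
  show "bij_betw fst {r \<in> A\<times>A. p dvd h + (fst r - snd r)} (shift_inter p A h)"
  proof (rule bij_betwI)
    have *: "(y + h) mod p = b \<longleftrightarrow> p dvd h + (y - b)" if "b \<in> A" for y b
    proof -
      have "b mod p = b" using assms(2) that by auto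
      then have "(y + h) mod p = b \<longleftrightarrow> (y + h) mod p = b mod p" by simp
      also have "\<dots> \<longleftrightarrow> p dvd h + (y - b)" by (simp add: mod_eq_dvd_iff algebra_simps)
      finally show ?thesis .
    qed
    show "fst \<in> {r \<in> A\<times>A. p dvd h + (fst r - snd r)} \<rightarrow> shift_inter p A h"
    proof (rule funcsetI)
      fix r assume r: "r \<in> {r \<in> A\<times>A. p dvd h + (fst r - snd r)}"
      then have "fst r \<in> A" "snd r \<in> A" by auto
      moreover from this have "(fst r + h) mod p = snd r" using *[of "snd r" "fst r"] r by simp
      ultimately show "fst r \<in> shift_inter p A h" by (simp add: shift_inter_def)
    qed
    show "(\<lambda>y. (y, (y + h) mod p)) \<in> shift_inter p A h \<rightarrow> {r \<in> A\<times>A. p dvd h + (fst r - snd r)}"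
    proof (rule funcsetI)
      fix y assume "y \<in> shift_inter p A h"
      then show "(y, (y + h) mod p) \<in> {r \<in> A\<times>A. p dvd h + (fst r - snd r)}"
        using *[of "(y + h) mod p" y] by (simp add: shift_inter_def)
    qed
    show "(fst r, (fst r + h) mod p) = r" if "r \<in> {r \<in> A\<times>A. p dvd h + (fst r - snd r)}" for r
      using that * by (cases r) auto
  qed simp
qed

text \<open>Katz--Koester: if \<open>y\<close> and \<open>y + h\<close> lie in \<open>A\<close>, then \<open>A + y\<close> and its translate by \<open>h\<close>
  lie in \<open>A + A\<close>.\<close>
lemma modsum_shift_inter_subset:
  "modsum p A (shift_inter p A h) \<subseteq> shift_inter p (modsum p A A) h"
proof
  fix x assume "x \<in> modsum p A (shift_inter p A h)"
  then obtain a y where x: "x = (a + y) mod p" "a \<in> A" "y \<in> A" "(y + h) mod p \<in> A"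
    by (auto elim!: modsumE simp: shift_inter_def)
  have "(x + h) mod p = (a + (y + h) mod p) mod p"
    unfolding x(1) by (simp only: mod_add_left_eq mod_add_right_eq add.assoc)
  then show "x \<in> shift_inter p (modsum p A A) h"
    using x by (auto simp: shift_inter_def intro: modsumI)
qed

text \<open>Cauchy-Davenport for \<open>A\<close> and \<open>shift_inter p A h\<close>, followed by
  the Katz-Koester inclusion. The minimum cannot be \<open>p\<close>, since the sumset involved has
  no more elements than \<open>modsum p A A\<close>.\<close>

lemma card_shift_inter_modsum_ge:
  assumes "prime p" "A \<subseteq> {0..<p}" "A \<noteq> {}" "shift_inter p A h \<noteq> {}" "int (card (modsum p A A)) < p"
  shows "int (card A) + int (card (shift_inter p A h)) - 1 \<le> int (card (shift_inter p (modsum p A A) h))"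
proof -
  have fin: "finite (modsum p A A)" using assms(2) by (intro finite_modsum) (auto intro: finite_subset)
  have "card (shift_inter p (modsum p A A) h) \<le> card (modsum p A A)"
    using fin by (intro card_mono) (auto simp: shift_inter_def)
  moreover have "card (modsum p A (shift_inter p A h)) \<le> card (shift_inter p (modsum p A A) h)"
    using fin by (intro card_mono modsum_shift_inter_subset) (auto simp: shift_inter_def)
  moreover have "min p (int (card A) + int (card (shift_inter p A h)) - 1)
      \<le> int (card (modsum p A (shift_inter p A h)))"
    using assms by (intro cauchy_davenport) (auto simp: shift_inter_def)
  ultimately show ?thesis using assms(5) by linarith
qed

text \<open>Cauchy-Schwarz for the representation counts \<open>R s\<close> of sums, whose total is
  \<open>|A|^2\<close>. A solution of \<open>a + y = a' + y'\<close> is determined by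
  \<open>a\<close>, \<open>a'\<close> and \<open>y\<close>, and \<open>y + (a - a')\<close> lies in
  \<open>A\<close>; this turns the sum of squares into counts of differences.\<close>

lemma energy_ge:
  assumes "0 < p" "A \<subseteq> {0..<p}"
  shows "real (card A) ^ 4
    \<le> real (card (modsum p A A)) * (\<Sum>q\<in>A\<times>A. real (card (shift_inter p A (fst q - snd q))))"
proof -
  have fin: "finite A" using assms(2) finite_subset by blast
  define S where "S = modsum p A A"
  have finS: "finite S" unfolding S_def using fin by (simp add: finite_modsum)
  define R where "R s = {r \<in> A\<times>A. (fst r + snd r) mod p = s}" for s
  have finR: "finite (R s)" for s unfolding R_def using fin by simp
  have un: "(\<Union>s\<in>S. R s) = A\<times>A" by (auto simp: R_def S_def intro: modsumI)
  have "card (\<Union>s\<in>S. R s) = (\<Sum>s\<in>S. card (R s))"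
    by (rule card_UN_disjoint) (use finS finR in \<open>auto simp: R_def\<close>)
  then have sumR: "(\<Sum>s\<in>S. real (card (R s))) = real (card A) ^ 2"
    unfolding un by (metis card_cartesian_product of_nat_mult of_nat_sum power2_eq_square)
  define U where "U = (\<Union>s\<in>S. R s \<times> R s)"
  have "card U = (\<Sum>s\<in>S. card (R s \<times> R s))"
    unfolding U_def by (rule card_UN_disjoint) (use finS finR in \<open>auto simp: R_def\<close>)
  then have cU: "real (card U) = (\<Sum>s\<in>S. (real (card (R s)))\<^sup>2)"
    by (simp add: card_cartesian_product power2_eq_square)
  define T where "T = Sigma (A\<times>A) (\<lambda>q. shift_inter p A (fst q - snd q))"
  have finT: "finite T" unfolding T_def using fin by (intro finite_SigmaI) (auto simp: shift_inter_def)
  have cT: "card T = (\<Sum>q\<in>A\<times>A. card (shift_inter p A (fst q - snd q)))"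
    unfolding T_def using fin by (intro card_SigmaI) (auto simp: shift_inter_def)
  have key: "(y + (a - a')) mod p = y'"
    if "(a + y) mod p = (a' + y') mod p" "y' \<in> A" for a a' y y'
  proof -
    have "y' mod p = y'" using assms(2) that(2) by auto
    moreover have "(y + (a - a')) mod p = y' mod p" using that(1) by (simp add: mod_eq_dvd_iff algebra_simps)
    ultimately show ?thesis by simp
  qed
  let ?f = "\<lambda>((a, y), (a', y')). ((a, a'), y)"
  have "card U \<le> card T"
  proof (rule card_inj_on_le[of ?f])
    show "inj_on ?f U"
    proof (rule inj_onI)
      fix r r' assume r: "r \<in> U" "r' \<in> U" "?f r = ?f r'"
      obtain a y a' y' where 1: "r = ((a, y), (a', y'))" by (metis surj_pair)
      obtain z' where 2: "r' = ((a, y), (a', z'))" using r(3) unfolding 1 by (cases r') auto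
      have "(a + y) mod p = (a' + y') mod p" "y' \<in> A" "(a + y) mod p = (a' + z') mod p" "z' \<in> A"
        using r unfolding 1 2 by (auto simp: U_def R_def)
      then show "r = r'" using key[of a y a' y'] key[of a y a' z'] unfolding 1 2 by simp
    qed
    show "?f ` U \<subseteq> T"
    proof clarify
      fix a y a' y' assume "((a, y), (a', y')) \<in> U"
      then have "(a + y) mod p = (a' + y') mod p" "a \<in> A" "y \<in> A" "a' \<in> A" "y' \<in> A"
        by (auto simp: U_def R_def)
      then show "((a, a'), y) \<in> T" using key[of a y a' y'] by (auto simp: T_def shift_inter_def)
    qed
  qed (rule finT)
  then have "(\<Sum>s\<in>S. (real (card (R s)))\<^sup>2) \<le> (\<Sum>q\<in>A\<times>A. real (card (shift_inter p A (fst q - snd q))))"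
    unfolding cU[symmetric] of_nat_sum[symmetric] cT[symmetric] by simp
  moreover have "(\<Sum>s\<in>S. real (card (R s)))\<^sup>2 \<le> real (card S) * (\<Sum>s\<in>S. (real (card (R s)))\<^sup>2)"
    using sum_squared_le_sum_of_squares[of "\<lambda>s. real (card (R s))" S] by (simp add: mult.commute)
  ultimately have "(real (card A) ^ 2)\<^sup>2 \<le> real (card S) * (\<Sum>q\<in>A\<times>A. real (card (shift_inter p A (fst q - snd q))))"
    unfolding sumR by (meson mult_left_mono of_nat_0_le_iff order_trans)
  then show ?thesis unfolding S_def by (simp add: power_mult[symmetric])
qed

lemma mixed_energy_ge:
  assumes "prime p" "A \<subseteq> {0..<p}" "A \<noteq> {}" "int (card (modsum p A A)) < p"
  defines "a \<equiv> real (card A)" and "t \<equiv> real (card (modsum p A A))"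
  shows "a\<^sup>2 * (a - 1) + a ^ 4 / t + a * (t - 2 * a + 1)
    \<le> (\<Sum>q\<in>A\<times>A. real (card {r \<in> modsum p A A \<times> modsum p A A. p dvd (fst q - snd q) + (fst r - snd r)}))"
proof -
  let ?B = "modsum p A A"
  have p0: "0 < p" using assms(1) by (simp add: prime_gt_0_int)
  have fin: "finite A" using assms(2) finite_subset by blast
  \<comment> \<open>Off the diagonal this is the Katz-Koester bound. For
    \<open>fst q = snd q\<close> both intersections are the full sets, and the correction raises
    \<open>2 a - 1\<close> to the exact value \<open>t\<close>.\<close>
  define g where "g q = a + real (card (shift_inter p A (fst q - snd q))) - 1
      + (if fst q = snd q then t - 2 * a + 1 else 0)" for q :: "int \<times> int"
  have "g q \<le> real (card (shift_inter p ?B (fst q - snd q)))" if q: "q \<in> A\<times>A" for q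
  proof (cases "fst q = snd q")
    case True
    have id: "shift_inter p X 0 = X" if "X \<subseteq> {0..<p}" for X
      using that by (auto simp: shift_inter_def)
    show ?thesis using True id[OF assms(2)] id[OF modsum_subset[OF p0]]
      by (simp add: g_def a_def t_def)
  next
    case False
    have "fst q \<in> A" "snd q \<in> A" using q by auto
    then have "snd q \<in> shift_inter p A (fst q - snd q)" using assms(2) by (auto simp: shift_inter_def)
    then have "int (card A) + int (card (shift_inter p A (fst q - snd q))) - 1
        \<le> int (card (shift_inter p ?B (fst q - snd q)))"
      using assms by (intro card_shift_inter_modsum_ge) auto
    then show ?thesis using False by (simp add: g_def a_def)
  qed
  then have "(\<Sum>q\<in>A\<times>A. g q) \<le> (\<Sum>q\<in>A\<times>A. real (card (shift_inter p ?B (fst q - snd q))))"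
    by (rule sum_mono)
  also have "\<dots> = (\<Sum>q\<in>A\<times>A. real (card {r \<in> ?B \<times> ?B. p dvd (fst q - snd q) + (fst r - snd r)}))"
    using card_differences[OF p0 modsum_subset[OF p0]] by simp
  finally have 1: "(\<Sum>q\<in>A\<times>A. g q) \<le> \<dots>" .
  have "(\<Sum>q\<in>A\<times>A. g q) = (\<Sum>q\<in>A\<times>A. a - 1) + (\<Sum>q\<in>A\<times>A. real (card (shift_inter p A (fst q - snd q))))
      + (\<Sum>q\<in>A\<times>A. if fst q = snd q then t - 2 * a + 1 else 0)"
    unfolding g_def sum.distrib[symmetric] by (intro sum.cong refl) simp
  also have "(\<Sum>q\<in>A\<times>A. a - 1) = a\<^sup>2 * (a - 1)"
    by (simp add: a_def card_cartesian_product power2_eq_square)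
  also have "(\<Sum>q\<in>A\<times>A. if fst q = snd q then t - 2 * a + 1 else 0)
      = (\<Sum>x\<in>A. \<Sum>y\<in>A. if x = y then t - 2 * a + 1 else 0)"
    by (simp add: sum.cartesian_product split_def)
  also have "\<dots> = a * (t - 2 * a + 1)" using fin by (simp add: a_def)
  finally have 2: "(\<Sum>q\<in>A\<times>A. g q) = a\<^sup>2 * (a - 1)
      + (\<Sum>q\<in>A\<times>A. real (card (shift_inter p A (fst q - snd q)))) + a * (t - 2 * a + 1)" .
  have "t > 0"
    using assms(3) fin unfolding t_def by (auto simp: card_gt_0_iff finite_modsum intro: modsumI)
  then have "a ^ 4 / t \<le> (\<Sum>q\<in>A\<times>A. real (card (shift_inter p A (fst q - snd q))))"
    using energy_ge[OF p0 assms(2)] by (simp add: a_def t_def divide_le_eq mult.commute)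
  then show ?thesis using 1 2 by linarith
qed

text \<open>In the fourth moment the frequency \<open>0\<close> contributes \<open>a^2 t^2\<close>.
  At the other frequencies the coefficients of \<open>A\<close> are bounded by \<open>m\<close>, and
  Parseval for \<open>A + A\<close> sums what remains to \<open>p t - t^2\<close>.\<close>

lemma fourier_sq_bound:
  assumes "prime p" "A \<subseteq> {0..<int p}" "A \<noteq> {}" "card (modsum (int p) A A) < p"
  defines "a \<equiv> real (card A)" and "t \<equiv> real (card (modsum (int p) A A))"
  assumes m: "\<And>\<xi>. 0 < \<xi> \<Longrightarrow> \<xi> < p \<Longrightarrow> (norm (fourier p A \<xi>))\<^sup>2 \<le> m"
  shows "real p * (a\<^sup>2 * (a - 1) + a ^ 4 / t + a * (t - 2 * a + 1)) \<le> a\<^sup>2 * t\<^sup>2 + m * (real p * t - t\<^sup>2)"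
proof -
  let ?B = "modsum (int p) A A"
  have p0: "0 < p" using assms(1) by (simp add: prime_gt_0_nat)
  have fin: "finite A" "finite ?B" using finite_subset[OF assms(2)] by (simp_all add: finite_modsum)
  have f0: "fourier p X 0 = of_nat (card X)" for X
    by (simp add: fourier_def unity_root_def)
  have split: "(\<Sum>\<xi><p. h \<xi>) = h 0 + (\<Sum>\<xi>\<in>{0<..<p}. h \<xi>)" for h :: "nat \<Rightarrow> real"
  proof -
    have "{..<p} = insert 0 {0<..<p}" using p0 by auto
    then show ?thesis by simp
  qed
  have "real p * (a\<^sup>2 * (a - 1) + a ^ 4 / t + a * (t - 2 * a + 1))
      \<le> real p * (\<Sum>q\<in>A\<times>A. real (card {r \<in> ?B \<times> ?B. int p dvd (fst q - snd q) + (fst r - snd r)}))"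
    unfolding a_def t_def using assms(1-4) by (intro mult_left_mono mixed_energy_ge) auto
  also have "\<dots> = (\<Sum>\<xi><p. (norm (fourier p A \<xi>))\<^sup>2 * (norm (fourier p ?B \<xi>))\<^sup>2)"
    using fourth_moment[OF p0 fin] by simp
  also have "\<dots> = a\<^sup>2 * t\<^sup>2 + (\<Sum>\<xi>\<in>{0<..<p}. (norm (fourier p A \<xi>))\<^sup>2 * (norm (fourier p ?B \<xi>))\<^sup>2)"
    by (simp add: split f0 a_def t_def)
  also have "(\<Sum>\<xi>\<in>{0<..<p}. (norm (fourier p A \<xi>))\<^sup>2 * (norm (fourier p ?B \<xi>))\<^sup>2)
      \<le> (\<Sum>\<xi>\<in>{0<..<p}. m * (norm (fourier p ?B \<xi>))\<^sup>2)"
    using m by (intro sum_mono mult_right_mono) auto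
  also have "(\<Sum>\<xi>\<in>{0<..<p}. m * (norm (fourier p ?B \<xi>))\<^sup>2) = m * (real p * t - t\<^sup>2)"
    using parseval[OF p0 modsum_subset, of A A] p0
    by (simp add: split f0 t_def sum_distrib_left[symmetric])
  finally show ?thesis by simp
qed

text \<open>With \<open>U = ((2K - 3)/3)\<^sup>2\<close>, the constant \<open>c\<close> is the solution of
  \<open>U = 1/K + 1/K\<^sup>2 - 3/(K s) + 1/s - K c (1 - U)\<close>.\<close>
lemma density_condition:
  fixes a t p K s c :: real
  assumes "2 < K" "K < 3" "K\<^sup>2 \<le> s"
    and c: "c = (- 27 * K + 9 * K\<^sup>2 + s * (9 + 9 * K - 9 * K\<^sup>2 + 12 * K ^ 3 - 4 * K ^ 4))
             / (4 * s * (3 - K) * K ^ 4)"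
    and "s \<le> a" "a \<le> c * p" "0 < t" "t < p" "t \<le> K * a"
  shows "a\<^sup>2 * t\<^sup>2 + (a * (2 * K - 3) / 3)\<^sup>2 * (p * t - t\<^sup>2)
    < p * (a\<^sup>2 * (a - 1) + a ^ 4 / t + a * (t - 2 * a + 1))"
proof -
  define U where "U = ((2 * K - 3) / 3)\<^sup>2"
  have "K * K \<ge> 2 * 2" using assms(1) by (intro mult_mono) auto
  then have s4: "4 \<le> s" using assms(3) by (simp add: power2_eq_square)
  then have a4: "4 \<le> a" using assms by simp
  have p0: "0 < p" using assms by simp
  have U1: "U < 1" unfolding U_def using assms(1,2) by (simp add: power_less_one_iff abs_square_less_1)
  have eq: "U = 1 / K + 1 / K\<^sup>2 - 3 / (K * s) + 1 / s - K * c * (1 - U)"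
  proof -
    define N where "N = - 27 * K + 9 * K\<^sup>2 + s * (9 + 9 * K - 9 * K\<^sup>2 + 12 * K ^ 3 - 4 * K ^ 4)"
    have "1 - U = 4 * K * (3 - K) / 9" unfolding U_def by (simp add: field_simps power2_eq_square)
    then have "K * c * (1 - U) = K * (N / (4 * s * (3 - K) * K ^ 4)) * (4 * K * (3 - K) / 9)"
      unfolding c N_def by (rule arg_cong)
    also have "\<dots> = N / (9 * s * K\<^sup>2)"
      using assms(1,2) s4 by (simp add: divide_simps) (simp add: power_numeral_reduce)
    finally have kc: "K * c * (1 - U) = N / (9 * s * K\<^sup>2)" .
    have "U = 1 / K + 1 / K\<^sup>2 - 3 / (K * s) + 1 / s - N / (9 * s * K\<^sup>2)"
      unfolding U_def N_def using assms(1) s4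
      by (simp add: divide_simps) (simp add: algebra_simps power_numeral_reduce)
    then show ?thesis unfolding kc .
  qed
  define \<kappa> where "\<kappa> = t / a"
  have \<kappa>: "0 < \<kappa>" "\<kappa> \<le> K" using assms a4 by (auto simp: \<kappa>_def field_simps)
  \<comment> \<open>The right-hand side of the goal divided by \<open>a^2 t p\<close>, without the
    \<open>+ 1\<close> in its last factor; that \<open>+ 1\<close> supplies the strict inequality at
    the end.\<close>
  define X where "X = 1 / \<kappa> + 1 / \<kappa>\<^sup>2 - 3 / (\<kappa> * a) + 1 / a"
  \<comment> \<open>Passing from \<open>s\<close> to the larger \<open>a\<close> increases the
    expression because \<open>3 - K > 0\<close>; passing from \<open>K\<close> to the smaller
    \<open>\<kappa>\<close> does so because \<open>a > 3\<close>.\<close>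
  have "1 / K + 1 / K\<^sup>2 - 3 / (K * s) + 1 / s \<le> 1 / K + 1 / K\<^sup>2 - 3 / (K * a) + 1 / a"
  proof -
    have e: "- 3 / (K * y) + 1 / y = - ((3 - K) / K) * (1 / y)" if "0 < y" for y
      using that assms(1) by (simp add: field_simps)
    have "((3 - K) / K) * (1 / a) \<le> ((3 - K) / K) * (1 / s)"
      using assms s4 by (intro mult_left_mono) (auto simp: frac_le)
    then show ?thesis using e[of a] e[of s] a4 s4 by simp
  qed
  also have "\<dots> \<le> X"
  proof -
    have e: "1 / y - 3 / (y * a) = (1 - 3 / a) * (1 / y)" if "0 < y" for y
      using that a4 by (simp add: field_simps)
    have "(1 - 3 / a) * (1 / K) \<le> (1 - 3 / a) * (1 / \<kappa>)"
      using \<kappa> a4 by (intro mult_left_mono) (auto simp: frac_le)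
    moreover have "1 / K\<^sup>2 \<le> 1 / \<kappa>\<^sup>2" using \<kappa> by (intro divide_left_mono) (auto simp: power_mono)
    ultimately show ?thesis using e[of K] e[of \<kappa>] \<kappa> assms(1) unfolding X_def by linarith
  qed
  finally have "U + K * c * (1 - U) \<le> X" using eq by linarith
  moreover have "t / p \<le> K * c"
  proof -
    have "t \<le> K * (c * p)" using assms by (smt (verit) mult_left_mono)
    then show ?thesis using p0 by (simp add: field_simps)
  qed
  then have "t / p * (1 - U) \<le> K * c * (1 - U)" using U1 by (intro mult_right_mono) auto
  ultimately have "U + t / p * (1 - U) \<le> X" by linarith
  then have "(a\<^sup>2 * t * p) * (U + t / p * (1 - U)) \<le> (a\<^sup>2 * t * p) * X"
    using assms(7) p0 by (intro mult_left_mono) auto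
  moreover have "(a\<^sup>2 * t * p) * (U + t / p * (1 - U)) = a\<^sup>2 * t\<^sup>2 + (a * (2 * K - 3) / 3)\<^sup>2 * (p * t - t\<^sup>2)"
  proof -
    have "(a * (2 * K - 3) / 3)\<^sup>2 = a\<^sup>2 * U" by (simp add: U_def power_mult_distrib power_divide)
    then show ?thesis using p0 by (simp add: field_simps power2_eq_square)
  qed
  moreover have "(a\<^sup>2 * t * p) * X = p * (a\<^sup>2 * (a - 1) + a ^ 4 / t + a * (t - 2 * a))"
    unfolding X_def \<kappa>_def using assms(7) a4 by (simp add: field_simps power2_eq_square power_numeral_reduce)
  moreover have "p * (a\<^sup>2 * (a - 1) + a ^ 4 / t + a * (t - 2 * a)) < p * (a\<^sup>2 * (a - 1) + a ^ 4 / t + a * (t - 2 * a + 1))"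
    using p0 a4 by (intro mult_strict_left_mono) (auto simp: algebra_simps)
  ultimately show ?thesis by linarith
qed

section \<open>Rectification\<close>

abbreviation affine_mod :: "int \<Rightarrow> int \<Rightarrow> int \<Rightarrow> int \<Rightarrow> int" where
  "affine_mod p d e \<equiv> \<lambda>x. (d * x + e) mod p"

lemma modsum_affine:
  "modsum p (affine_mod p d e ` X) (affine_mod p d e' ` Y) = affine_mod p d (e + e') ` (X + Y)"
proof -
  have *: "(affine_mod p d e x + affine_mod p d e' y) mod p = affine_mod p d (e + e') (x + y)" for x y
    by (simp only: mod_add_eq) (simp add: algebra_simps)
  show ?thesis
  proof
    show "modsum p (affine_mod p d e ` X) (affine_mod p d e' ` Y) \<subseteq> affine_mod p d (e + e') ` (X + Y)"
    proof
      fix s assume "s \<in> modsum p (affine_mod p d e ` X) (affine_mod p d e' ` Y)"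
      then obtain x y where "s = (affine_mod p d e x + affine_mod p d e' y) mod p" "x \<in> X" "y \<in> Y"
        by (auto elim!: modsumE)
      then show "s \<in> affine_mod p d (e + e') ` (X + Y)" unfolding * by (blast intro: set_plus_intro)
    qed
    show "affine_mod p d (e + e') ` (X + Y) \<subseteq> modsum p (affine_mod p d e ` X) (affine_mod p d e' ` Y)"
    proof
      fix s assume "s \<in> affine_mod p d (e + e') ` (X + Y)"
      then obtain x y where s: "s = affine_mod p d (e + e') (x + y)" and xy: "x \<in> X" "y \<in> Y"
        by (auto elim!: set_plus_elim)
      show "s \<in> modsum p (affine_mod p d e ` X) (affine_mod p d e' ` Y)"
        unfolding s *[symmetric] using xy by (intro modsumI imageI)
    qed
  qed
qed

text \<open>On \<open>p\<close> consecutive integers the affine map is a bijection onto the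
  residues. If \<open>S\<close> avoids the images of the first \<open>l\<close> of them, it comes
  entirely from the other \<open>p - l\<close>.\<close>

lemma preimage_outside_interval:
  fixes p d e u l :: int
  assumes "coprime d p" "0 < p" "S \<subseteq> {0..<p}" "0 \<le> l" "\<And>i. u \<le> i \<Longrightarrow> i < u + l \<Longrightarrow> affine_mod p d e i \<notin> S"
  shows "\<exists>W \<subseteq> {u+l..<u+p}. S = affine_mod p d e ` W \<and> card W = card S"
proof -
  let ?f = "affine_mod p d e"
  have inj: "inj_on ?f {u..<u+p}" using assms(1) by (rule inj_on_affine_mod)
  have "?f ` {u..<u+p} = {0..<p}"
    using card_image[OF inj] assms(2) by (intro card_subset_eq) auto
  moreover define W where "W = {w \<in> {u..<u+p}. ?f w \<in> S}"
  ultimately have S: "S = ?f ` W"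
  proof -
    have "x \<in> ?f ` W" if "x \<in> S" for x
    proof -
      have "x \<in> ?f ` {u..<u+p}" using that assms(3) \<open>?f ` {u..<u+p} = {0..<p}\<close> by blast
      then show ?thesis using that by (auto simp: W_def)
    qed
    then show ?thesis by (auto simp: W_def)
  qed
  have "card S = card W" unfolding S by (rule card_image) (rule inj_on_subset[OF inj], auto simp: W_def)
  moreover have "W \<subseteq> {u+l..<u+p}" using assms(5) by (force simp: W_def)
  ultimately show ?thesis using S by auto
qed

lemma sum_contains_interval_symmetric:
  fixes X Y :: "int set"
  assumes "finite X" "finite Y" "X \<subseteq> {0..m}" "Y \<subseteq> {0..n}" "0 \<in> X" "m \<in> X" "0 \<in> Y" "n \<in> Y"
    and "m + 3 \<le> int (card X) + int (card Y)" "n + 3 \<le> int (card X) + int (card Y)"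
    and "int (card (X + Y)) \<le> 2 * int (card X) + int (card Y) - 4"
    and "int (card (X + Y)) \<le> int (card X) + 2 * int (card Y) - 4"
  shows "\<exists>u. {u..u + int (card X) + int (card Y) - 2} \<subseteq> X + Y"
proof (cases "m \<le> n")
  case True
  then show ?thesis
    using sum_contains_interval[where X = X and Y = Y and m = m and n = n] assms by auto
next
  case False
  then have "\<exists>u. {u..u + int (card Y) + int (card X) - 2} \<subseteq> Y + X"
    using sum_contains_interval[where X = Y and Y = X and m = n and n = m] assms by (auto simp: add.commute)
  then show ?thesis by (simp add: add.commute add.left_commute)
qed

lemma affine_image_plus:
  fixes g b c :: int
  shows "(\<lambda>y. b + g * y) ` Y + (\<lambda>y. c + g * y) ` Z = (\<lambda>s. (b + c) + g * s) ` (Y + Z)"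
proof
  have *: "(b + g * y) + (c + g * z) = (b + c) + g * (y + z)" for y z by (simp add: algebra_simps)
  show "(\<lambda>y. b + g * y) ` Y + (\<lambda>y. c + g * y) ` Z \<subseteq> (\<lambda>s. (b + c) + g * s) ` (Y + Z)"
  proof
    fix s assume "s \<in> (\<lambda>y. b + g * y) ` Y + (\<lambda>y. c + g * y) ` Z"
    then obtain y z where "s = (b + g * y) + (c + g * z)" "y \<in> Y" "z \<in> Z" by (auto elim!: set_plus_elim)
    then show "s \<in> (\<lambda>s. (b + c) + g * s) ` (Y + Z)" unfolding * by (blast intro: set_plus_intro)
  qed
  show "(\<lambda>s. (b + c) + g * s) ` (Y + Z) \<subseteq> (\<lambda>y. b + g * y) ` Y + (\<lambda>y. c + g * y) ` Z"
  proof
    fix s assume "s \<in> (\<lambda>s. (b + c) + g * s) ` (Y + Z)"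
    then obtain y z where s: "s = (b + c) + g * (y + z)" and "y \<in> Y" "z \<in> Z" by (auto elim!: set_plus_elim)
    then show "s \<in> (\<lambda>y. b + g * y) ` Y + (\<lambda>y. c + g * y) ` Z"
      unfolding s *[symmetric] by (intro set_plus_intro imageI)
  qed
qed

text \<open>Since \<open>2 * h < p\<close>, sums of two elements of \<open>X\<close> do not wrap
  around, and the sumset has the same size over the integers. Subtracting the minimum and dividing
  by the gcd \<open>g\<close> gives the normal form for Freiman's theorem; as
  \<open>0 < g < p\<close>, the factor \<open>g\<close> is invertible modulo \<open>p\<close> and
  can be absorbed into the slope.\<close>

lemma freiman_3k4_rectified:
  fixes p :: int
  assumes "prime p" "coprime d p" "A = affine_mod p d e ` X" "X \<subseteq> {0..h}" "2 * h < p"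
    and small: "card (modsum p A A) + 4 \<le> 3 * card A"
  shows "\<exists>d' e' Y m u. coprime d' p \<and> A = affine_mod p d' e' ` Y \<and> finite Y \<and> card Y = card A \<and> Y \<subseteq> {0..m}
    \<and> 0 \<in> Y \<and> m \<in> Y \<and> m + int (card A) \<le> int (card (modsum p A A))
    \<and> {u..u + 2 * int (card A) - 2} \<subseteq> Y + Y"
proof -
  have p0: "0 < p" using assms(1) by (simp add: prime_gt_0_int)
  have finX: "finite X" using assms(4) finite_subset by blast
  have Xne: "X \<noteq> {}" using small assms(3) by auto
  then have h0: "0 \<le> h" using assms(4) by auto
  have cX: "card A = card X" unfolding assms(3)
    by (rule card_image, rule inj_on_subset[OF inj_on_affine_mod[OF assms(2), of e 0]]) (use assms(4,5) h0 in auto)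
  have "X + X \<subseteq> {0..<0+p}"
  proof
    fix s assume "s \<in> X + X"
    then obtain x y where "s = x + y" "x \<in> X" "y \<in> X" by (rule set_plus_elim)
    moreover from this have "x \<in> {0..h}" "y \<in> {0..h}" using assms(4) by blast+
    ultimately show "s \<in> {0..<0+p}" using assms(5) by simp
  qed
  then have cXX: "card (modsum p A A) = card (X + X)"
    unfolding assms(3) modsum_affine by (intro card_image inj_on_subset[OF inj_on_affine_mod[OF assms(2)]])
  define x0 where "x0 = Min X"
  have x0: "x0 \<in> X" "\<And>x. x \<in> X \<Longrightarrow> x0 \<le> x" unfolding x0_def using finX Xne by auto
  define g where "g = Gcd ((\<lambda>x. x - x0) ` X)"
  have gd: "g dvd x - x0" if "x \<in> X" for x unfolding g_def using that by simp
  have "X \<noteq> {x0}" using small cX by auto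
  then obtain x1 where x1: "x1 \<in> X" "x1 \<noteq> x0" using x0 by blast
  have g0: "0 < g"
  proof -
    have "g \<noteq> 0" using gd[OF x1(1)] x1(2) by auto
    moreover have "0 \<le> g" unfolding g_def by (rule Gcd_int_greater_eq_0)
    ultimately show ?thesis by simp
  qed
  have "g \<le> x1 - x0" using gd[OF x1(1)] x0(2)[OF x1(1)] x1(2) by (intro zdvd_imp_le) auto
  moreover have "x1 \<in> {0..h}" "x0 \<in> {0..h}" using x1(1) x0(1) assms(4) by blast+
  ultimately have "g < p" using assms(5) h0 by simp
  then have "\<not> p dvd g" using g0 zdvd_not_zless by blast
  then have gp: "coprime g p" using prime_imp_coprime[OF assms(1)] coprime_commute by blast
  define Y where "Y = (\<lambda>x. (x - x0) div g) ` X"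
  have XY: "X = (\<lambda>y. x0 + g * y) ` Y" using gd by (force simp: Y_def image_image)
  have injg: "inj (\<lambda>y. b + g * y)" for b using g0 by (auto intro!: injI)
  have cY: "card Y = card X" unfolding XY by (rule card_image[symmetric], rule inj_on_subset[OF injg]) simp
  have "X + X = (\<lambda>s. (x0 + x0) + g * s) ` (Y + Y)"
    unfolding XY by (rule affine_image_plus)
  then have cYY: "card (X + X) = card (Y + Y)" by (simp add: card_image inj_on_subset[OF injg])
  have "Gcd Y = 1"
  proof -
    have "(\<lambda>x. x - x0) ` X = (*) g ` Y" unfolding XY by (simp add: image_image)
    then have "Gcd ((\<lambda>x. x - x0) ` X) = normalize (g * Gcd Y)" by (simp only: Gcd_mult)
    then have "g = normalize (g * Gcd Y)" by (simp only: g_def)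
    then have "g = g * Gcd Y" using g0 by (simp add: abs_mult)
    then show ?thesis using g0 by simp
  qed
  moreover have finY: "finite Y" unfolding Y_def using finX by simp
  moreover have Y0: "0 \<in> Y" using x0 unfolding Y_def by (auto intro!: image_eqI[of _ _ x0])
  moreover have Ym: "Max Y \<in> Y" using finY Y0 by (intro Max_in) auto
  moreover have YI: "Y \<subseteq> {0..Max Y}"
  proof
    fix y assume y: "y \<in> Y"
    then have "0 \<le> y" using x0(2) g0 by (auto simp: Y_def pos_imp_zdiv_nonneg_iff)
    then show "y \<in> {0..Max Y}" using y finY by simp
  qed
  moreover have "card (Y + Y) + 4 \<le> 3 * card Y" using small cX cY cXX cYY by simp
  ultimately have F: "Max Y + int (card Y) \<le> int (card (Y + Y))" "\<exists>u. {u..u + 2 * int (card Y) - 2} \<subseteq> Y + Y"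
    using freiman_3k4[of Y "Max Y"] by blast+
  have "A = affine_mod p (d * g) (d * x0 + e) ` Y"
    unfolding assms(3) by (subst XY) (simp add: image_image algebra_simps)
  moreover have "coprime (d * g) p" using assms(2) gp by simp
  moreover have "Max Y + int (card A) \<le> int (card (modsum p A A))" using F(1) cX cY cXX cYY by simp
  moreover have "\<exists>u. {u..u + 2 * int (card A) - 2} \<subseteq> Y + Y" using F(2) cX cY by simp
  moreover have "card Y = card A" using cX cY by simp
  ultimately show ?thesis using finY Y0 Ym YI by blast
qed

text \<open>Passes from a half circle for \<open>A'\<close> to one for all of \<open>A\<close>. With
  \<open>C\<close> the complement of \<open>A + A\<close>, the set \<open>C - A'\<close> never meets
  \<open>A\<close>, so a long progression inside it leaves only a short window for
  \<open>A\<close>.\<close>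

lemma rectify_superset:
  fixes p :: int
  assumes "prime p" "A \<subseteq> {0..<p}" "A' \<subseteq> A" "coprime d p" "A' = affine_mod p d e ` X"
    and "X \<subseteq> {0..h}" "2 * h < p"
    and dens: "4 * int (card (modsum p A A)) \<le> 3 * p"
    and small: "card (modsum p A A) + 4 \<le> 3 * card A'"
  shows "\<exists>d e Z h. coprime d p \<and> A = affine_mod p d e ` Z \<and> Z \<subseteq> {0..h} \<and> 2 * h < p"
proof (cases "A' = A")
  case True
  then show ?thesis using assms by blast
next
  case False
  have p0: "0 < p" using assms(1) by (simp add: prime_gt_0_int)
  have finA: "finite A" using assms(2) finite_subset by blast
  have finA': "finite A'" using assms(3) finA finite_subset by blast
  have AA_sub: "modsum p A A \<subseteq> {0..<p}" using modsum_subset[OF p0] .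
  have finAA: "finite (modsum p A A)" using finA by (simp add: finite_modsum)
  define a a1 t where "a = int (card A)" and "a1 = int (card A')" and "t = int (card (modsum p A A))"
  \<comment> \<open>Proper inclusion gains one unit, which is spent in
    \<open>2 * t + 4 \<le> p + a + a1\<close>.\<close>
  have "A' \<subset> A" using False assms(3) by blast
  then have a_gt: "a1 + 1 \<le> a" using psubset_card_mono[OF finA, of A'] by (simp add: a_def a1_def)
  have sm: "t + 4 \<le> 3 * a1" and ds: "4 * t \<le> 3 * p" using small dens by (simp_all add: t_def a1_def)
  have AA': "modsum p A' A' \<subseteq> modsum p A A" using assms(3) by (auto elim!: modsumE intro: modsumI)
  have t': "card (modsum p A' A') \<le> card (modsum p A A)" by (rule card_mono[OF finAA AA'])
  then have "card (modsum p A' A') + 4 \<le> 3 * card A'" using small by simp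
  from freiman_3k4_rectified[OF assms(1,4,5,6,7) this]
  obtain d e Y m u where d: "coprime d p" and A': "A' = affine_mod p d e ` Y" and Y: "finite Y" "card Y = card A'"
    "Y \<subseteq> {0..m}" "0 \<in> Y" "m \<in> Y" and m: "m + int (card A') \<le> int (card (modsum p A' A'))"
    and u: "{u..u + 2 * int (card A') - 2} \<subseteq> Y + Y" by blast
  have m': "m \<le> t - a1" using m t' by (simp add: t_def a1_def)
  have m0: "0 \<le> m" using Y by auto
  define C where "C = {0..<p} - modsum p A A"
  have cC: "int (card C) = p - t"
    unfolding C_def using AA_sub finAA p0 card_mono[OF _ AA_sub] by (simp add: card_Diff_subset t_def)
  have "\<exists>W \<subseteq> {u+(2*a1-1)..<u+p}. C = affine_mod p d (e + e) ` W \<and> card W = card C"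
  proof (rule preimage_outside_interval[OF d p0])
    fix i assume i: "u \<le> i" "i < u + (2 * a1 - 1)"
    then have "i \<in> Y + Y" using u by (auto simp: a1_def)
    then have "affine_mod p d (e + e) i \<in> modsum p A' A'" unfolding A' modsum_affine by (rule imageI)
    then show "affine_mod p d (e + e) i \<notin> C" using AA' by (auto simp: C_def)
  qed (use sm a_gt in \<open>auto simp: C_def t_def\<close>)
  then obtain W where W: "W \<subseteq> {u+(2*a1-1)..<u+p}" "C = affine_mod p d (e + e) ` W" "card W = card C" by blast
  have finW: "finite W" using W(1) finite_subset by blast
  have "0 < card W" using cC W(3) ds p0 sm by linarith
  then have Wne: "W \<noteq> {}" by auto
  define w0 n where "w0 = Min W" and "n = Max W - w0"
  have w0: "w0 \<in> W" "\<And>w. w \<in> W \<Longrightarrow> w0 \<le> w" "\<And>w. w \<in> W \<Longrightarrow> w - w0 \<le> n" "n + w0 \<in> W"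
    unfolding w0_def n_def using finW Wne by auto
  have "w0 \<in> {u+(2*a1-1)..<u+p}" "n + w0 \<in> {u+(2*a1-1)..<u+p}" using w0(1,4) W(1) by blast+
  then have n: "n \<le> p - 2 * a1" by simp
  \<comment> \<open>Reflecting \<open>Y\<close> turns the difference set \<open>W - Y\<close> into a
    sumset of normalised sets; the shift \<open>v\<close> undoes both normalisations.\<close>
  define Y2 where "Y2 = (\<lambda>y. m - y) ` Y"
  define W2 where "W2 = (\<lambda>w. w - w0) ` W"
  have Y2: "finite Y2" "Y2 \<subseteq> {0..m}" "0 \<in> Y2" "m \<in> Y2"
    using Y by (auto simp: Y2_def intro!: image_eqI[of _ _ 0] image_eqI[of _ _ m])
  have cY2: "int (card Y2) = a1" unfolding Y2_def a1_def using Y(2) by (simp add: card_image inj_on_def)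
  have W2: "finite W2" "W2 \<subseteq> {0..n}" "0 \<in> W2" "n \<in> W2"
    using finW w0 by (auto simp: W2_def intro!: image_eqI[of _ _ w0] image_eqI[of _ _ "n + w0"])
  have cW2: "int (card W2) = p - t" unfolding W2_def using W(3) cC by (simp add: card_image inj_on_def)
  define v where "v = w0 - m"
  have avoid: "affine_mod p d e (s + v) \<notin> A" if s: "s \<in> Y2 + W2" for s
  proof
    obtain y w where yw: "s + v = w - y" "y \<in> Y" "w \<in> W"
      using s by (auto elim!: set_plus_elim simp: Y2_def W2_def v_def)
    assume "affine_mod p d e (s + v) \<in> A"
    moreover have "affine_mod p d e y \<in> A" using yw A' assms(3) by blast
    ultimately have "(affine_mod p d e (s + v) + affine_mod p d e y) mod p \<in> modsum p A A" by (rule modsumI)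
    also have "(affine_mod p d e (s + v) + affine_mod p d e y) mod p = affine_mod p d (e + e) w"
      unfolding yw(1) by (simp only: mod_add_eq) (simp add: algebra_simps)
    finally show False using W(2) yw(3) by (auto simp: C_def)
  qed
  \<comment> \<open>Because \<open>m + n < p\<close>, distinct integer sums give distinct residues,
    all of them outside \<open>A\<close>.\<close>
  have sub: "(\<lambda>s. s + v) ` (Y2 + W2) \<subseteq> {v..<v+p}"
  proof -
    have "0 \<le> s \<and> s \<le> m + n" if "s \<in> Y2 + W2" for s
      using that Y2(2) W2(2) by (force elim!: set_plus_elim)
    moreover have "m + n < p" using n m' sm by linarith
    ultimately show ?thesis by fastforce
  qed
  have "int (card (Y2 + W2)) \<le> p - a"
  proof -
    have "card (Y2 + W2) = card ((\<lambda>s. s + v) ` (Y2 + W2))" by (simp add: card_image inj_on_def)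
    also have "\<dots> = card (affine_mod p d e ` (\<lambda>s. s + v) ` (Y2 + W2))"
      by (rule card_image[symmetric], rule inj_on_subset[OF inj_on_affine_mod[OF d] sub])
    also have "\<dots> \<le> card ({0..<p} - A)" using avoid p0 by (intro card_mono) auto
    finally show ?thesis
      using assms(2) finA p0 card_mono[OF _ assms(2)] by (simp add: card_Diff_subset a_def)
  qed
  \<comment> \<open>From \<open>4 t \<le> 3 p\<close> and \<open>t + 4 \<le> 3 a1\<close> follows
    \<open>2 t + 8/3 \<le> p + 2 a1\<close>, and integrality rounds up. The same inequality finally
    places \<open>A\<close> in less than half of the residues plus one.\<close>
  moreover have "2 * t + 3 \<le> p + 2 * a1" using sm ds by linarith
  moreover from this have "2 * t + 4 \<le> p + a + a1" using a_gt by linarith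
  ultimately have "int (card (Y2 + W2)) \<le> 2 * a1 + (p - t) - 4" "int (card (Y2 + W2)) \<le> a1 + 2 * (p - t) - 4"
    using sm a_gt by simp_all
  moreover have "m + 3 \<le> a1 + (p - t)" "n + 3 \<le> a1 + (p - t)"
    using m' n sm \<open>2 * t + 3 \<le> p + 2 * a1\<close> by simp_all
  ultimately have "\<exists>u. {u..u + int (card Y2) + int (card W2) - 2} \<subseteq> Y2 + W2"
    using sum_contains_interval_symmetric[OF Y2(1) W2(1) Y2(2) W2(2) Y2(3,4) W2(3,4)] unfolding cY2 cW2 by blast
  then obtain z where z: "{z..z + a1 + (p - t) - 2} \<subseteq> Y2 + W2" unfolding cY2 cW2 by blast
  \<comment> \<open>The length of the progression that avoids \<open>A\<close>; it leaves
    \<open>p - l = t - a1 + 1\<close> consecutive coordinates.\<close>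
  define l where "l = a1 + (p - t) - 1"
  have "\<exists>Z \<subseteq> {z+v+l..<z+v+p}. A = affine_mod p d e ` Z \<and> card Z = card A"
  proof (rule preimage_outside_interval[OF d p0 assms(2)])
    show "0 \<le> l" using sm ds p0 by (simp add: l_def)
    fix i assume "z + v \<le> i" "i < z + v + l"
    then have "i - v \<in> Y2 + W2" using z by (auto simp: l_def)
    then show "affine_mod p d e i \<notin> A" using avoid[of "i - v"] by simp
  qed
  then obtain Z where Z: "Z \<subseteq> {z+v+l..<z+v+p}" "A = affine_mod p d e ` Z" by blast
  define b where "b = z + v + l"
  have "A = affine_mod p d (d * b + e) ` (\<lambda>x. x - b) ` Z"
    unfolding Z(2) by (simp add: image_image algebra_simps)
  moreover have "(\<lambda>x. x - b) ` Z \<subseteq> {0..t - a1}" using Z(1) by (force simp: b_def l_def)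
  moreover have "2 * (t - a1) < p" using \<open>2 * t + 3 \<le> p + 2 * a1\<close> by simp
  ultimately show ?thesis using d by blast
qed

lemma abs_le_half_pi_of_cos_nonneg:
  fixes x :: real
  assumes "0 \<le> cos x"
  shows "\<exists>j::int. \<bar>x - 2 * pi * of_int j\<bar> \<le> pi / 2"
proof -
  define j where "j = round (x / (2 * pi))"
  define y where "y = x - 2 * pi * of_int j"
  have "\<bar>of_int j - x / (2 * pi)\<bar> \<le> 1 / 2" unfolding j_def by (rule of_int_round_abs_le)
  then have "2 * pi * \<bar>of_int j - x / (2 * pi)\<bar> \<le> 2 * pi * (1 / 2)" by (intro mult_left_mono) auto
  also have "2 * pi * \<bar>of_int j - x / (2 * pi)\<bar> = \<bar>2 * pi * (of_int j - x / (2 * pi))\<bar>" by (simp add: abs_mult)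
  also have "2 * pi * (of_int j - x / (2 * pi)) = - y" by (simp add: y_def field_simps)
  finally have yp: "\<bar>y\<bar> \<le> pi" by simp
  have "x = y + 2 * pi * of_int j" by (simp add: y_def)
  then have "cos x = cos y" using cos.plus_of_int[of y j] by (simp add: mult_ac)
  then have "0 \<le> cos \<bar>y\<bar>" using assms by simp
  have "\<bar>y\<bar> \<le> pi / 2"
  proof (rule ccontr)
    assume "\<not> \<bar>y\<bar> \<le> pi / 2"
    then have "cos \<bar>y\<bar> < cos (pi / 2)" using yp by (intro cos_monotone_0_pi) auto
    then show False using \<open>0 \<le> cos \<bar>y\<bar>\<close> by simp
  qed
  then show ?thesis unfolding y_def by blast
qed

text \<open>A half plane collects those \<open>a\<close> for which \<open>\<xi> a\<close> lies on a
  half circle; multiplying by the inverse \<open>d\<close> of \<open>\<xi>\<close> turns this arc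
  into a progression.\<close>

lemma large_coefficient_half_arc:
  fixes p :: nat
  assumes "prime p" "2 < p" "A \<subseteq> {0..<int p}" "0 < \<xi>" "\<xi> < p"
  shows "\<exists>A' d e X h. A' \<subseteq> A \<and> coprime d (int p) \<and> A' = affine_mod (int p) d e ` X \<and> X \<subseteq> {0..h} \<and> 2 * h < int p
     \<and> real (card A) + norm (fourier p A \<xi>) \<le> 2 * real (card A')"
proof -
  have p0: "0 < int p" using assms(2) by simp
  have fin: "finite A" using assms(3) finite_subset by blast
  obtain w where w: "norm w = 1" and big: "real (card A) + norm (fourier p A \<xi>)
      \<le> 2 * real (card {a \<in> A. 0 \<le> Re (unity_root p (int \<xi> * a) * w)})"
    using closed_half_plane_exists[OF fin, of "\<lambda>a. unity_root p (int \<xi> * a)"]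
    unfolding fourier_def by auto
  define A' where "A' = {a \<in> A. 0 \<le> Re (unity_root p (int \<xi> * a) * w)}"
  have "w \<noteq> 0" using w by auto
  then have "cis (Arg w) = w" using w by (simp add: cis_Arg sgn_eq)
  then obtain \<tau> where \<tau>: "w = cis \<tau>" by metis
  have "\<not> int p dvd int \<xi>" using assms(4,5) zdvd_not_zless[of "int \<xi>" "int p"] by simp
  then have "coprime (int \<xi>) (int p)"
    using prime_imp_coprime[of "int p" "int \<xi>"] assms(1) by (simp add: coprime_commute)
  then obtain d where d: "[int \<xi> * d = 1] (mod int p)" using cong_solve_coprime_int by blast
  have dc: "coprime d (int p)"
    using d by (metis cong_imp_coprime cong_sym coprime_1_left coprime_mult_left_iff)
  \<comment> \<open>The first integer of the arc: up to multiples of \<open>p\<close>, the half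
    plane requires \<open>\<xi> a\<close> to be within \<open>p / 4\<close> of
    \<open>- \<tau> p / (2 pi)\<close>.\<close>
  define b where "b = \<lceil>- (\<tau> * p / (2 * pi)) - p / 4\<rceil>"
  have *: "\<exists>x \<in> {0..int p div 2}. a = affine_mod (int p) d (d * b) x" if "a \<in> A'" for a
  proof -
    define k where "k = int \<xi> * a"
    have "0 \<le> cos (2 * pi * of_int k / p + \<tau>)"
      using that by (simp add: A'_def k_def unity_root_def \<tau> cis_mult)
    then obtain j where "\<bar>2 * pi * of_int k / p + \<tau> - 2 * pi * of_int j\<bar> \<le> pi / 2"
      using abs_le_half_pi_of_cos_nonneg by blast
    then have "(p / (2 * pi)) * \<bar>2 * pi * of_int k / p + \<tau> - 2 * pi * of_int j\<bar> \<le> (p / (2 * pi)) * (pi / 2)"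
      by (intro mult_left_mono) auto
    also have "(p / (2 * pi)) * \<bar>2 * pi * of_int k / p + \<tau> - 2 * pi * of_int j\<bar>
        = \<bar>(p / (2 * pi)) * (2 * pi * of_int k / p + \<tau> - 2 * pi * of_int j)\<bar>" by (simp add: abs_mult)
    also have "(p / (2 * pi)) * (2 * pi * of_int k / p + \<tau> - 2 * pi * of_int j)
        = of_int (k - j * int p) + \<tau> * p / (2 * pi)" using assms(2) by (simp add: field_simps)
    finally have abs: "\<bar>of_int (k - j * int p) + \<tau> * p / (2 * pi)\<bar> \<le> p / 4" by simp
    have "- (\<tau> * p / (2 * pi)) - p / 4 \<le> of_int (k - j * int p)"
      using abs_le_D2[OF abs] by linarith
    then have lo: "b \<le> k - j * int p" unfolding b_def by (rule ceiling_le)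
    have "- (\<tau> * p / (2 * pi)) - p / 4 \<le> of_int b" unfolding b_def by (rule le_of_int_ceiling)
    then have "real_of_int (k - j * int p) - of_int b \<le> p / 2" using abs_le_D1[OF abs] by linarith
    then have "real_of_int (2 * (k - j * int p - b)) \<le> real_of_int (int p)" by simp
    then have hi: "2 * (k - j * int p - b) \<le> int p" by (simp only: of_int_le_iff)
    define x where "x = k - j * int p - b"
    have "x \<in> {0..int p div 2}" using lo hi by (auto simp: x_def)
    moreover have "a = affine_mod (int p) d (d * b) x"
    proof -
      have "d * x + d * b = (int \<xi> * d) * a - (d * j) * int p" by (simp add: x_def k_def algebra_simps)
      then have "affine_mod (int p) d (d * b) x = ((int \<xi> * d) * a) mod int p"
        by (simp add: mod_eq_dvd_iff)
      also have "\<dots> = (1 * a) mod int p" using cong_scalar_right[OF d, of a] by (simp add: cong_def)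
      also have "\<dots> = a" using that assms(3) by (auto simp: A'_def)
      finally show ?thesis by simp
    qed
    ultimately show ?thesis by blast
  qed
  define X where "X = {x \<in> {0..int p div 2}. affine_mod (int p) d (d * b) x \<in> A'}"
  have "A' = affine_mod (int p) d (d * b) ` X"
  proof
    show "A' \<subseteq> affine_mod (int p) d (d * b) ` X"
    proof
      fix a assume a: "a \<in> A'"
      from *[OF this] obtain x where "x \<in> {0..int p div 2}" "a = affine_mod (int p) d (d * b) x" by (rule bexE)
      with a show "a \<in> affine_mod (int p) d (d * b) ` X"
        by (intro image_eqI[of _ _ x]) (simp_all add: X_def)
    qed
  qed (auto simp: X_def)
  moreover have "X \<subseteq> {0..int p div 2}" by (auto simp: X_def)
  \<comment> \<open>The arc has length \<open>p / 2\<close>; the inequality is strict because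
    \<open>p\<close> is odd.\<close>
  moreover have "2 * (int p div 2) < int p"
  proof -
    have "odd p" using assms(1,2) by (simp add: prime_odd_nat)
    then show ?thesis by presburger
  qed
  moreover have "A' \<subseteq> A" by (auto simp: A'_def)
  ultimately show ?thesis using dc big unfolding A'_def[symmetric] by blast
qed

section \<open>Arithmetic progressions in the residue ring\<close>

lemma residue_ring_add_pow:
  assumes "1 < p" "d \<in> carrier (residue_ring p)"
  shows "[(i::nat)] \<cdot>\<^bsub>residue_ring p\<^esub> d = (int i * d) mod p"
proof -
  interpret residues p "residue_ring p" using assms(1) by unfold_locales simp_all
  show ?thesis
  proof (induction i)
    case 0
    then show ?case by (simp add: zero_cong)
  next
    case (Suc i)
    have "[Suc i] \<cdot>\<^bsub>residue_ring p\<^esub> d = [i] \<cdot>\<^bsub>residue_ring p\<^esub> d \<oplus>\<^bsub>residue_ring p\<^esub> d"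
      using assms(2) by (simp add: add.nat_pow_Suc)
    also have "\<dots> = ((int i * d) mod p + d) mod p" unfolding Suc by (simp add: res_add_eq)
    also have "\<dots> = (int (Suc i) * d) mod p" by (simp only: mod_add_left_eq) (simp add: algebra_simps)
    finally show ?case .
  qed
qed

lemma arith_progression_residue_ring:
  assumes "1 < p" "1 \<le> n"
  shows "arith_progression (residue_ring p) (d mod p) (affine_mod p d b ` {0..<n})"
proof -
  have car: "carrier (residue_ring p) = {0..<p}" by (auto simp: residue_ring_def)
  have d: "d mod p \<in> carrier (residue_ring p)" using assms(1) by (simp add: car)
  have *: "b mod p \<oplus>\<^bsub>residue_ring p\<^esub> [i] \<cdot>\<^bsub>residue_ring p\<^esub> (d mod p) = affine_mod p d b (int i)" for i :: nat
    unfolding residue_ring_add_pow[OF assms(1) d]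
    by (simp add: residue_ring_def mod_simps algebra_simps)
  have "affine_mod p d b ` {0..<n}
      = {b mod p \<oplus>\<^bsub>residue_ring p\<^esub> [i] \<cdot>\<^bsub>residue_ring p\<^esub> (d mod p) | i. i < nat n}" (is "_ = ?P")
  proof
    show "affine_mod p d b ` {0..<n} \<subseteq> ?P"
    proof
      fix x assume "x \<in> affine_mod p d b ` {0..<n}"
      then obtain y where "x = affine_mod p d b y" "0 \<le> y" "y < n" by auto
      then show "x \<in> ?P" unfolding * by (intro CollectI exI[of _ "nat y"]) auto
    qed
    show "?P \<subseteq> affine_mod p d b ` {0..<n}" unfolding * by auto
  qed
  moreover have "1 \<le> nat n" using assms(2) by simp
  moreover have "b mod p \<in> carrier (residue_ring p)" using assms(1) by (simp add: car)
  ultimately show ?thesis unfolding arith_progression_def using d by blast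
qed

text \<open>The span bound gives the progression around \<open>A\<close>. The
  \<open>2 |A| - 1\<close> consecutive coordinates inside \<open>Y + Y\<close> leave
  \<open>p - 2 |A| + 1 = |C| + r + 1\<close> of them for the complement of the sumset.\<close>

lemma progressions_of_rectified:
  fixes p :: int
  assumes "prime p" "A \<subseteq> {0..<p}" "coprime d p" "A = affine_mod p d e ` X" "X \<subseteq> {0..h}" "2 * h < p"
    and small: "card (modsum p A A) + 4 \<le> 3 * card A" and "modsum p A A \<noteq> {0..<p}"
  defines "C \<equiv> (\<lambda>x. (- x) mod p) ` ({0..<p} - modsum p A A)"
    and "r \<equiv> int (card (modsum p A A)) - 2 * int (card A)"
  shows "\<exists>d P Q. arith_progression (residue_ring p) d P \<and> arith_progression (residue_ring p) d Q \<and>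
    A \<subseteq> P \<and> int (card P) \<le> int (card A) + r + 1 \<and> C \<subseteq> Q \<and> int (card Q) \<le> int (card C) + r + 1"
proof -
  have p0: "0 < p" "1 < p" using assms(1) by (simp_all add: prime_gt_0_int prime_gt_1_int)
  have finA: "finite A" using assms(2) finite_subset by blast
  have AA_sub: "modsum p A A \<subseteq> {0..<p}" using modsum_subset[OF p0(1)] .
  have finAA: "finite (modsum p A A)" using finA by (simp add: finite_modsum)
  from freiman_3k4_rectified[OF assms(1,3,4,5,6) small]
  obtain d e Y m u where d: "coprime d p" and A: "A = affine_mod p d e ` Y" and Y: "Y \<subseteq> {0..m}" "0 \<in> Y"
    and m: "m + int (card A) \<le> int (card (modsum p A A))"
    and u: "{u..u + 2 * int (card A) - 2} \<subseteq> Y + Y" by blast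
  have m0: "0 \<le> m" using Y by auto
  define P where "P = affine_mod p d e ` {0..<m+1}"
  have P: "arith_progression (residue_ring p) (d mod p) P" unfolding P_def
    using p0 m0 by (intro arith_progression_residue_ring) auto
  have AP: "A \<subseteq> P" unfolding A P_def using Y(1) by (intro image_mono) auto
  have "card P \<le> card {0..<m+1}" unfolding P_def by (intro card_image_le) simp
  then have cP: "int (card P) \<le> int (card A) + r + 1" using m m0 by (simp add: r_def)
  define l where "l = 2 * int (card A) - 1"
  define D where "D = {0..<p} - modsum p A A"
  have cD: "int (card D) = p - int (card (modsum p A A))"
    unfolding D_def using AA_sub finAA p0 card_mono[OF _ AA_sub] by (simp add: card_Diff_subset)
  have l: "0 \<le> l" using small by (simp add: l_def)
  have "\<exists>W \<subseteq> {u+l..<u+p}. D = affine_mod p d (e + e) ` W \<and> card W = card D"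
  proof (rule preimage_outside_interval[OF d p0(1) _ l])
    fix i assume i: "u \<le> i" "i < u + l"
    then have "i \<in> Y + Y" using u by (auto simp: l_def)
    then have "affine_mod p d (e + e) i \<in> modsum p A A" unfolding A modsum_affine by (rule imageI)
    then show "affine_mod p d (e + e) i \<notin> D" by (simp add: D_def)
  qed (auto simp: D_def)
  then obtain W where W: "W \<subseteq> {u+l..<u+p}" "D = affine_mod p d (e + e) ` W" by blast
  have "D \<noteq> {}" using assms(8) AA_sub by (auto simp: D_def)
  then obtain w where "w \<in> W" using W by blast
  then have "w \<in> {u+l..<u+p}" using W(1) by blast
  then have lp: "l < p" by simp
  \<comment> \<open>Counting coordinates down from the top \<open>u + p - 1\<close> compensates the
    sign in \<open>C\<close>, so that its progression has difference \<open>d\<close> like that of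
    \<open>A\<close>, not \<open>- d\<close>.\<close>
  define b where "b = - (d * (u + p - 1) + (e + e))"
  define Q where "Q = affine_mod p d b ` {0..<p - l}"
  have Q: "arith_progression (residue_ring p) (d mod p) Q" unfolding Q_def
    using p0 lp by (intro arith_progression_residue_ring) auto
  have "C \<subseteq> Q"
  proof
    fix x assume "x \<in> C"
    then obtain w where w: "x = (- affine_mod p d (e + e) w) mod p" "w \<in> W"
      using W(2) unfolding C_def D_def[symmetric] by blast
    have "w \<in> {u+l..<u+p}" using w(2) W(1) by blast
    then have "u + p - 1 - w \<in> {0..<p-l}" by simp
    moreover have "x = affine_mod p d b (u + p - 1 - w)"
      unfolding w(1) mod_minus_eq by (simp add: b_def algebra_simps)
    ultimately show "x \<in> Q" unfolding Q_def by (rule rev_image_eqI)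
  qed
  moreover have "card C = card D"
  proof -
    have "inj_on (\<lambda>x. (- x) mod p) {0..<0+p}" using inj_on_affine_mod[of "-1" p 0 0] by simp
    then show ?thesis unfolding C_def D_def by (intro card_image) (auto elim: inj_on_subset)
  qed
  moreover have "card Q \<le> card {0..<p - l}" unfolding Q_def by (intro card_image_le) simp
  then have "int (card Q) \<le> p - l" using lp by simp
  ultimately show ?thesis using P Q AP cP cD by (intro exI[of _ "d mod p"] exI[of _ P] exI[of _ Q]) (simp add: r_def l_def)
qed

theorem theorem3p8:
  fixes p :: nat and G :: "int ring"
    and A C :: "int set" and K s c :: real and r :: int
  assumes "prime p"
    and "G = residue_ring (int p)"
    and "A \<subseteq> carrier G" and "A \<noteq> {}"
    and "A <+>\<^bsub>G\<^esub> A \<noteq> carrier G"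
    and "C = (\<lambda>x. \<ominus>\<^bsub>G\<^esub> x) ` (carrier G - (A <+>\<^bsub>G\<^esub> A))"
    and "2 < K" and "K < 3"
    and "s \<ge> K\<^sup>2"
    and "c = (- 27 * K + 9 * K\<^sup>2 + s * (9 + 9 * K - 9 * K\<^sup>2 + 12 * K ^ 3 - 4 * K ^ 4))
             / (4 * s * (3 - K) * K ^ 4)"
    and "s \<le> real (card A)" and "real (card A) \<le> c * real p"
    and "int (card (A <+>\<^bsub>G\<^esub> A)) = 2 * int (card A) + r"
    and "real (card (A <+>\<^bsub>G\<^esub> A)) \<le> 3 / 4 * real p"
    and "real (card (A <+>\<^bsub>G\<^esub> A)) < K * real (card A) - 3"
  shows "\<exists>d P_A P_C.
           arith_progression G d P_A \<and> arith_progression G d P_C \<and>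
           A \<subseteq> P_A \<and> int (card P_A) \<le> int (card A) + r + 1 \<and>
           C \<subseteq> P_C \<and> int (card P_C) \<le> int (card C) + r + 1"
proof -
  have p1: "1 < int p" and p0: "0 < int p" and pr: "prime (int p)"
    using assms(1) prime_gt_1_nat[OF assms(1)] by auto
  interpret residues "int p" "residue_ring (int p)" using p1 by unfold_locales simp_all
  have car: "carrier G = {0..<int p}" unfolding assms(2) by (auto simp: residue_ring_def)
  have AI: "A \<subseteq> {0..<int p}" using assms(3) car by simp
  have fin: "finite A" using AI finite_subset by blast
  define B where "B = modsum (int p) A A"
  have AA: "A <+>\<^bsub>G\<^esub> A = B"
  proof
    show "A <+>\<^bsub>G\<^esub> A \<subseteq> B" by (auto simp: assms(2) B_def set_add_def' res_add_eq intro: modsumI)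
    show "B \<subseteq> A <+>\<^bsub>G\<^esub> A" by (auto simp: assms(2) B_def set_add_def' res_add_eq elim!: modsumE)
  qed
  have BI: "B \<subseteq> {0..<int p}" unfolding B_def using modsum_subset[OF p0] .
  have C: "C = (\<lambda>x. (- x) mod int p) ` ({0..<int p} - B)"
    unfolding assms(6) AA car by (intro image_cong refl) (simp add: assms(2) res_neg_eq)
  have Bne: "B \<noteq> {0..<int p}" using assms(5) AA car by simp
  then have "B \<subset> {0..<int p}" using BI by blast
  then have "card B < card {0..<int p}" by (intro psubset_card_mono) auto
  then have Bp: "card B < p" by simp
  have "B \<noteq> {}" using assms(4) by (auto simp: B_def intro: modsumI)
  then have B0: "0 < card B" using BI finite_subset by (auto simp: card_gt_0_iff)
  \<comment> \<open>The solution of \<open>(|A| + M) / 2 = K |A| / 3\<close>: a coefficient above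
    \<open>M\<close> puts more than \<open>K |A| / 3\<close> elements on a half circle, and
    \<open>K |A|\<close> exceeds \<open>|A + A| + 3\<close>.\<close>
  define M where "M = real (card A) * (2 * K - 3) / 3"
  have "\<exists>\<xi>. 0 < \<xi> \<and> \<xi> < p \<and> M < norm (fourier p A \<xi>)"
  proof (rule ccontr)
    assume no: "\<not> ?thesis"
    have "(norm (fourier p A \<xi>))\<^sup>2 \<le> M\<^sup>2" if "0 < \<xi>" "\<xi> < p" for \<xi>
    proof -
      have "norm (fourier p A \<xi>) \<le> M" using no that by (meson not_less)
      then show ?thesis by (rule power_mono) simp
    qed
    then have "real p * ((real (card A))\<^sup>2 * (real (card A) - 1) + real (card A) ^ 4 / real (card B)
        + real (card A) * (real (card B) - 2 * real (card A) + 1))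
        \<le> (real (card A))\<^sup>2 * (real (card B))\<^sup>2 + M\<^sup>2 * (real p * real (card B) - (real (card B))\<^sup>2)"
      unfolding B_def using assms(1,4) AI Bp by (intro fourier_sq_bound) (auto simp: B_def)
    moreover have "(real (card A))\<^sup>2 * (real (card B))\<^sup>2 + M\<^sup>2 * (real p * real (card B) - (real (card B))\<^sup>2)
        < real p * ((real (card A))\<^sup>2 * (real (card A) - 1) + real (card A) ^ 4 / real (card B)
        + real (card A) * (real (card B) - 2 * real (card A) + 1))"
      unfolding M_def using assms(7-12,15) B0 Bp AA by (intro density_condition) auto
    ultimately show False by linarith
  qed
  then obtain \<xi> where \<xi>: "0 < \<xi>" "\<xi> < p" "M < norm (fourier p A \<xi>)" by blast
  \<comment> \<open>At least four elements in \<open>A\<close> exclude \<open>p = 2\<close>, as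
    \<open>large_coefficient_half_arc\<close> demands.\<close>
  have "2 * 2 \<le> K * K" using assms(7) by (intro mult_mono) auto
  then have "4 \<le> real (card A)" using assms(9,11) by (simp add: power2_eq_square)
  moreover have "card A \<le> card {0..<int p}" using AI by (intro card_mono) auto
  ultimately have "2 < p" by simp
  from large_coefficient_half_arc[OF assms(1) this AI \<xi>(1,2)]
  obtain A' d e X h where A': "A' \<subseteq> A" and d: "coprime d (int p)" "A' = affine_mod (int p) d e ` X"
    "X \<subseteq> {0..h}" "2 * h < int p" and big: "real (card A) + norm (fourier p A \<xi>) \<le> 2 * real (card A')"
    by blast
  have "real (card A) + M < 2 * real (card A')" using big \<xi>(3) by linarith
  then have "K * real (card A) < 3 * real (card A')" by (simp add: M_def field_simps)
  then have "real (card B) + 3 < 3 * real (card A')" using assms(15) AA by simp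
  then have small': "card B + 4 \<le> 3 * card A'" by linarith
  have "4 * real (card B) \<le> 3 * real p" using assms(14) AA by simp
  then have dens: "4 * int (card B) \<le> 3 * int p" by linarith
  from rectify_superset[OF pr AI A' d] dens small'
  obtain d e Z h where Z: "coprime d (int p)" "A = affine_mod (int p) d e ` Z" "Z \<subseteq> {0..h}" "2 * h < int p"
    unfolding B_def by blast
  have "card A' \<le> card A" by (rule card_mono[OF fin A'])
  then have "card B + 4 \<le> 3 * card A" using small' by linarith
  then show ?thesis
    using progressions_of_rectified[OF pr AI Z] Bne assms(13) AA
    unfolding C B_def assms(2) by simp
qed

end
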